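(* For any non-empty $S\subseteq\{3,4,5,\dots\}\cup\{\infty\}$, the Polish group $G_S=\mathrm{Homeo}(D_S)$ is universally minimal: its Polish topology is coarser than (contained in) every Hausdorff group topology on $G_S$.
   Context: A dendrite is a connected, locally connected, metrizable compact space in which any two points are joined by a unique arc. The order of a point is the number of components of its complement; branch points are points of order at least $3$. For non-empty $S\subseteq\{3,4,\dots,\infty\}$, $D_S$ is the unique (up to homeomorphism) dendrite whose branch points all have order in $S$ and such that for each $n\in S$ the points of order $n$ meet the interior of every non-trivial arc. The Polish topology on $G_S=\mathrm{Homeo}(D_S)$ is the topology of pointwise convergence on the countable set of branch points (equivalently the compact-open topology). *)

theory Defs
  imports "HOL-Analysis.Analysis" "HOL-Library.Extended_Nat"
begin

definition is_arc_between :: "'a topology \<Rightarrow> 'a set \<Rightarrow> 'a \<Rightarrow> 'a \<Rightarrow> bool" where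
  "is_arc_between X A a b \<longleftrightarrow>
     (\<exists>h. embedding_map (top_of_set {0..1::real}) X h \<and> h ` {0..1} = A \<and> h 0 = a \<and> h 1 = b)"

definition dendrite :: "'a topology \<Rightarrow> bool" where
  "dendrite X \<longleftrightarrow> compact_space X \<and> connected_space X \<and> locally_connected_space X \<and>
     metrizable_space X \<and> (\<exists>x\<in>topspace X. \<exists>y\<in>topspace X. x \<noteq> y) \<and>
     (\<forall>a\<in>topspace X. \<forall>b\<in>topspace X. a \<noteq> b \<longrightarrow> (\<exists>!A. is_arc_between X A a b))"

definition point_order :: "'a topology \<Rightarrow> 'a \<Rightarrow> enat" where
  "point_order X x =
     (let C = connected_components_of (subtopology X (topspace X - {x}))
      in if finite C then enat (card C) else \<infinity>)"

definition branch_point :: "'a topology \<Rightarrow> 'a \<Rightarrow> bool" where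
  "branch_point X x \<longleftrightarrow> x \<in> topspace X \<and> point_order X x \<ge> 3"

definition is_D_S :: "enat set \<Rightarrow> 'a topology \<Rightarrow> bool" where
  "is_D_S S X \<longleftrightarrow> dendrite X \<and>
     (\<forall>x. branch_point X x \<longrightarrow> point_order X x \<in> S) \<and>
     (\<forall>n\<in>S. \<forall>A a b. a \<noteq> b \<and> is_arc_between X A a b \<longrightarrow>
         (\<exists>x\<in>A - {a, b}. point_order X x = n))"

text \<open>Homeo(X), with homeomorphisms normalised to be the identity outside topspace X,
  so that composition and the inverse below give the group structure.\<close>
definition Homeo :: "'a topology \<Rightarrow> ('a \<Rightarrow> 'a) set" where
  "Homeo X = {f. homeomorphic_map X X f \<and> (\<forall>x. x \<notin> topspace X \<longrightarrow> f x = x)}"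

definition homeo_inv :: "'a topology \<Rightarrow> ('a \<Rightarrow> 'a) \<Rightarrow> ('a \<Rightarrow> 'a)" where
  "homeo_inv X f = (\<lambda>y. if y \<in> topspace X then inv_into (topspace X) f y else y)"

text \<open>Compact-open topology on Homeo(X) (= the Polish topology of pointwise convergence
  on branch points).\<close>
definition compact_open_homeo :: "'a topology \<Rightarrow> ('a \<Rightarrow> 'a) topology" where
  "compact_open_homeo X =
     subtopology
       (topology_generated_by {{f. f ` K \<subseteq> U} | K U. compactin X K \<and> openin X U})
       (Homeo X)"

definition hausdorff_group_topology_homeo :: "'a topology \<Rightarrow> ('a \<Rightarrow> 'a) topology \<Rightarrow> bool" where
  "hausdorff_group_topology_homeo X T \<longleftrightarrow>
     topspace T = Homeo X \<and> Hausdorff_space T \<and>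
     continuous_map (prod_topology T T) T (\<lambda>(f, g). f \<circ> g) \<and>
     continuous_map T T (homeo_inv X)"

end

theory Submission
  imports Defs "HOL-Probability.Discrete_Topology"
begin

text \<open>
  In a Hausdorff group topology the set of all \<open>g\<close> for which \<open>g f g\<inverse>\<close> and \<open>h\<close> do not commute is open.
  If \<open>f\<close> and \<open>h\<close> are supported in a component \<open>C\<close> of the complement of a branch point \<open>x\<close>, then
  every such \<open>g\<close> satisfies \<open>g C \<inter> C \<noteq> {}\<close>; and if this happens for three components, then \<open>g\<close> fixes
  \<open>x\<close>. So, once every component supports two homeomorphisms that do not commute, stabilisers of branch
  points are open, and these generate the compact-open topology because the components of complements
  of branch points form a subbase of the dendrite.

  The homeomorphisms come from a back-and-forth argument on the countable set of branch points with
  the relation ``\<open>p\<close> separates \<open>a\<close> from \<open>b\<close>'': a finite partial isomorphism whose domain contains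
  the centre of any three of its points extends to any further branch point, and by compactness an
  automorphism of this structure extends to the dendrite. That points of an arc do separate its end
  points rests on the arcwise connectedness of connected open sets.
\<close>

section \<open>Arcs in locally connected compact metrizable spaces\<close>

text \<open>Nothing is known of \<open>T\<close> beyond continuity of the group operations and the
  Hausdorff property, so the only sets certain to be open are those where an equation between group
  words fails; hence neighbourhoods of the identity come from non-commutation and not from the
  action on points. A single component gives little: a map may satisfy
  \<open>g C \<inter> C \<noteq> {}\<close> and still move \<open>x\<close> into \<open>C\<close>.
  Order at least 3 supplies enough components to exclude this. Little homogeneity is needed: a
  branch point must be movable to another of the same order inside a component, with the rest fixed.
  Partial isomorphisms preserve orders because equal numbers of components guarantee room for the
  image of a new point. Closure under centres leaves few positions for such a point: on an edge
  between two points of the domain, hanging off a point of the domain, or hanging off an edge; the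
  last reduces to the other two. Density of the orders is given on arcs, whereas all else is phrased
  with components; hence the need to identify arcs with separation.\<close>

text \<open>A chain of small connected sets over a subdivision of \<open>[s, t]\<close>, recorded as a closed subset of the
  product. The intersection of a decreasing sequence of such sets with \<open>\<epsilon>\<close> tending to \<open>0\<close> is the graph of a path.\<close>

inductive link_chain :: "'b::metric_space set \<Rightarrow> real \<Rightarrow> real \<Rightarrow> real \<Rightarrow> 'b \<Rightarrow> 'b \<Rightarrow> (real \<times> 'b) set \<Rightarrow> bool"
  for K \<epsilon> where
  link: "\<lbrakk>openin (top_of_set K) U; connected U; a \<in> U; b \<in> U; s < t;
          \<And>x y. x \<in> closure U \<Longrightarrow> y \<in> closure U \<Longrightarrow> dist x y \<le> \<epsilon>\<rbrakk>
         \<Longrightarrow> link_chain K \<epsilon> s t a b ({s..t} \<times> closure U)"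
| join: "\<lbrakk>link_chain K \<epsilon> s t a b G; link_chain K \<epsilon> t u b c H\<rbrakk> \<Longrightarrow> link_chain K \<epsilon> s u a c (G \<union> H)"

lemma link_chain_closed:
  assumes "link_chain K \<epsilon> s t a b G"
  shows "closed G"
  using assms by induction (auto intro: closed_Times)

lemma link_chain_subset:
  assumes "link_chain K \<epsilon> s t a b G" "closed K"
  shows "G \<subseteq> {s..t} \<times> K \<and> s < t"
  using assms
proof induction
  case (link U a b s t)
  then have "closure U \<subseteq> K"
    by (intro closure_minimal openin_imp_subset)
  then show ?case
    using link by auto
next
  case (join s t a b G u c H)
  then have "{s..t} \<times> K \<subseteq> {s..u} \<times> K" "{t..u} \<times> K \<subseteq> {s..u} \<times> K" "s < u"
    by auto
  then show ?case using join by blast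
qed

lemma link_chain_section:
  assumes "link_chain K \<epsilon> s t a b G" "closed K" "r \<in> {s..t}"
  shows "\<exists>x. (r, x) \<in> G"
  using assms
proof induction
  case (link U a b s t)
  then show ?case using closure_subset by fastforce
next
  case (join s t a b G u c H)
  then show ?case
    by (cases "r \<le> t") auto
qed

text \<open>A link has sections of diameter at most \<open>\<epsilon>\<close>; only at a junction do
  two of them meet, and both contain the junction point, whence the factor 2. The finer bounds at
  the two ends are carried along because the next junction consumes them.\<close>

lemma link_chain_diameter:
  assumes "link_chain K \<epsilon> s t a b G" "closed K"
  shows "(s, a) \<in> G \<and> (t, b) \<in> G \<and> (\<forall>x. (s, x) \<in> G \<longrightarrow> dist x a \<le> \<epsilon>) \<and> (\<forall>x. (t, x) \<in> G \<longrightarrow> dist x b \<le> \<epsilon>)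
         \<and> (\<forall>r x y. (r, x) \<in> G \<longrightarrow> (r, y) \<in> G \<longrightarrow> dist x y \<le> 2 * \<epsilon>)"
  using assms
proof induction
  case (link U a b s t)
  have "0 \<le> \<epsilon>" 
    using link(3,6) closure_subset by (metis dist_self subsetD)
  moreover have "dist x y \<le> 2 * \<epsilon>" if "x \<in> closure U" "y \<in> closure U" for x y
    using link(6)[OF that] \<open>0 \<le> \<epsilon>\<close> by linarith
  ultimately show ?case
    using link closure_subset[of U] by auto
next
  case (join s t a b G u c H)
  have G: "G \<subseteq> {s..t} \<times> K" "s < t" and H: "H \<subseteq> {t..u} \<times> K" "t < u"
    using link_chain_subset join by blast+
  have "dist x y \<le> 2 * \<epsilon>" if "(r, x) \<in> G \<union> H" "(r, y) \<in> G \<union> H" for r x y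
  proof (cases "r = t")
    case True
    then have "dist x b \<le> \<epsilon>" "dist y b \<le> \<epsilon>"
      using that join by auto
    then show ?thesis
      by (metis (no_types, opaque_lifting) add_mono dist_commute dist_triangle_le mult_2)
  next
    case False
    then have "(r, x) \<in> G \<and> (r, y) \<in> G \<or> (r, x) \<in> H \<and> (r, y) \<in> H"
      using that G H by fastforce
    then show ?thesis using join by blast
  qed
  moreover have "(s, x) \<notin> H" "(u, x) \<notin> G" for x
    using G H by auto
  ultimately show ?case
    using join by blast
qed

lemma link_chain_exists:
  fixes K :: "'b::metric_space set"
  assumes "closed K"
    and lc: "\<And>V x. openin (top_of_set K) V \<Longrightarrow> x \<in> V \<Longrightarrow> 
               \<exists>U. openin (top_of_set K) U \<and> connected U \<and> x \<in> U \<and> U \<subseteq> V"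
    and U: "openin (top_of_set K) U" "connected U" "a \<in> U" "b \<in> U" and "0 < \<epsilon>" "s < t"
  shows "\<exists>G. link_chain K \<epsilon> s t a b G \<and> G \<subseteq> {s..t} \<times> U"
proof -
  have small: "\<exists>V. openin (top_of_set K) V \<and> connected V \<and> x \<in> V \<and> closure V \<subseteq> U \<and> 
                 (\<forall>y z. y \<in> closure V \<longrightarrow> z \<in> closure V \<longrightarrow> dist y z \<le> \<epsilon>)" if "x \<in> U" for x
  proof -
    obtain T where T: "open T" "U = K \<inter> T"
      using U(1) by (auto simp: openin_open)
    then obtain e where e: "0 < e" "cball x e \<subseteq> T"
      using \<open>x \<in> U\<close> open_contains_cball by blast
    define d where "d = min e (\<epsilon> / 2)"
    have d: "0 < d" "cball x d \<subseteq> T" "2 * d \<le> \<epsilon>"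
      using e \<open>0 < \<epsilon>\<close> by (auto simp: d_def)
    have "openin (top_of_set K) (K \<inter> ball x d)" "x \<in> K \<inter> ball x d"
      using \<open>x \<in> U\<close> T d by auto
    then obtain V where V: "openin (top_of_set K) V" "connected V" "x \<in> V" "V \<subseteq> K \<inter> ball x d"
      using lc by meson
    have "closure V \<subseteq> K \<inter> cball x d"
      using V(4) ball_subset_cball \<open>closed K\<close> by (intro closure_minimal) (auto simp: closed_Int)
    moreover have "dist y z \<le> \<epsilon>" if "y \<in> cball x d" "z \<in> cball x d" for y z
      using dist_triangle[of y z x] that d(3) by (simp add: dist_commute)
    ultimately have "closure V \<subseteq> U" "\<forall>y z. y \<in> closure V \<longrightarrow> z \<in> closure V \<longrightarrow> dist y z \<le> \<epsilon>"
      using d(2) T(2) by blast+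
    then show ?thesis
      using V by blast
  qed
  \<comment> \<open>All intervals are quantified over so that a chain to \<open>x\<close> can be
    squeezed into the first half of \<open>[s, t]\<close>, leaving the second half for the extra
    link.\<close>
  define R where "R = (\<lambda>b. \<forall>s t. s < t \<longrightarrow> (\<exists>G. link_chain K \<epsilon> s t a b G \<and> G \<subseteq> {s..t} \<times> U))"
  have step: "R y" if "R x" "openin (top_of_set K) V" "connected V" "x \<in> V" "y \<in> V" "closure V \<subseteq> U"
      "\<And>y z. y \<in> closure V \<Longrightarrow> z \<in> closure V \<Longrightarrow> dist y z \<le> \<epsilon>" for x y V
    unfolding R_def
  proof (intro allI impI)
    fix s t :: real
    assume "s < t"
    then have m: "s < (s+t)/2" "(s+t)/2 < t" by auto
    then obtain G where G: "link_chain K \<epsilon> s ((s+t)/2) a x G" "G \<subseteq> {s..(s+t)/2} \<times> U"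
      using \<open>R x\<close> R_def by blast
    have "link_chain K \<epsilon> ((s+t)/2) t x y ({(s+t)/2..t} \<times> closure V)"
      using that m by (intro link) auto
    moreover have "{(s+t)/2..t} \<times> closure V \<subseteq> {s..t} \<times> U" "G \<subseteq> {s..t} \<times> U"
      using m that(6) G(2) by fastforce+
    ultimately show "\<exists>G. link_chain K \<epsilon> s t a y G \<and> G \<subseteq> {s..t} \<times> U"
      using join[OF G(1)] by (metis Un_subset_iff)
  qed
  have "R a"
  proof -
    obtain V where V: "openin (top_of_set K) V" "connected V" "a \<in> V" "closure V \<subseteq> U"
        "\<forall>y z. y \<in> closure V \<longrightarrow> z \<in> closure V \<longrightarrow> dist y z \<le> \<epsilon>"
      using small \<open>a \<in> U\<close> by blast
    then show ?thesis
      unfolding R_def by (metis link Sigma_mono subset_refl)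
  qed
  have "R b"
  proof (rule connected_induction_simple[OF U(2) \<open>a \<in> U\<close> \<open>b \<in> U\<close>])
    show "R a" by fact
    fix x assume "x \<in> U"
    then obtain V where V: "openin (top_of_set K) V" "connected V" "x \<in> V" "closure V \<subseteq> U"
        "\<forall>y z. y \<in> closure V \<longrightarrow> z \<in> closure V \<longrightarrow> dist y z \<le> \<epsilon>"
      using small by blast
    then have "openin (top_of_set U) V"
      by (meson U(1) closure_subset dual_order.trans openin_imp_subset openin_subset_trans)
    then show "\<exists>T. openin (top_of_set U) T \<and> x \<in> T \<and> (\<forall>x\<in>T. \<forall>y\<in>T. R x \<longrightarrow> R y)"
      using V step by (intro exI[of _ V]) blast
  qed
  then show ?thesis
    using \<open>s < t\<close> R_def by blast
qed

text \<open>A link is built on a connected open \<open>U\<close> containing both its end points, so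
  a finer chain exists inside \<open>U\<close> itself and stays within the old link.\<close>

lemma link_chain_refine:
  fixes K :: "'b::metric_space set"
  assumes "link_chain K \<epsilon> s t a b G" "closed K"
    and lc: "\<And>V x. openin (top_of_set K) V \<Longrightarrow> x \<in> V \<Longrightarrow> 
               \<exists>U. openin (top_of_set K) U \<and> connected U \<and> x \<in> U \<and> U \<subseteq> V"
    and "0 < \<epsilon>'"
  shows "\<exists>H. link_chain K \<epsilon>' s t a b H \<and> H \<subseteq> G"
  using assms(1)
proof induction
  case (link U a b s t)
  then obtain H where "link_chain K \<epsilon>' s t a b H" "H \<subseteq> {s..t} \<times> U"
    using link_chain_exists[OF assms(2) lc _ _ _ _ assms(4)] by metis
  then show ?case
    using closure_subset by blast
next
  case (join s t a b G u c H)
  then show ?case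
    by (meson Un_mono link_chain.join)
qed

text \<open>The nested chains meet every vertical line over \<open>[0, 1]\<close> in non-empty
  compact sets of diameter tending to 0, hence in one common point; the limit is the graph of a
  function, and it is compact.\<close>

lemma locally_connected_compact_path:
  fixes K :: "'b::metric_space set"
  assumes "compact K"
    and lc: "\<And>V x. openin (top_of_set K) V \<Longrightarrow> x \<in> V \<Longrightarrow> 
               \<exists>U. openin (top_of_set K) U \<and> connected U \<and> x \<in> U \<and> U \<subseteq> V"
    and U: "openin (top_of_set K) U" "connected U" "a \<in> U" "b \<in> U"
  obtains f where "path f" "path_image f \<subseteq> U" "pathstart f = a" "pathfinish f = b"
proof -
  have K: "closed K" using assms(1) by (rule compact_imp_closed)
  define \<epsilon> where "\<epsilon> n = inverse (real (Suc n))" for n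
  obtain G0 where G0: "link_chain K (\<epsilon> 0) 0 1 a b G0" "G0 \<subseteq> {0..1} \<times> U"
    using link_chain_exists[OF K lc U, of "\<epsilon> 0" 0 1] by (auto simp: \<epsilon>_def)
  have "\<exists>G. G 0 = G0 \<and> (\<forall>n. link_chain K (\<epsilon> n) 0 1 a b (G n) \<and> G (Suc n) \<subseteq> G n)"
  proof -
    \<comment> \<open>The clause for \<open>n = 0\<close> fixes the first chain as
      \<open>G0\<close>, which lies over \<open>U\<close>; all later chains are contained in it, and
      this keeps the path in \<open>U\<close>.\<close>
    have "\<exists>G. \<forall>n. (link_chain K (\<epsilon> n) 0 1 a b (G n) \<and> (n = 0 \<longrightarrow> G n = G0)) \<and> G (Suc n) \<subseteq> G n"
    proof (rule dependent_nat_choice)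
      show "\<exists>x. link_chain K (\<epsilon> 0) 0 1 a b x \<and> (0 = 0 \<longrightarrow> x = G0)"
        using G0 by auto
      fix H :: "(real \<times> 'b) set" and n :: nat
      assume "link_chain K (\<epsilon> n) 0 1 a b H \<and> (n = 0 \<longrightarrow> H = G0)"
      then show "\<exists>y. (link_chain K (\<epsilon> (Suc n)) 0 1 a b y \<and> (Suc n = 0 \<longrightarrow> y = G0)) \<and> y \<subseteq> H"
        using link_chain_refine[OF _ K lc, of _ 0 1 a b _ "\<epsilon> (Suc n)"] by (force simp: \<epsilon>_def)
    qed
    then show ?thesis by blast
  qed
  then obtain G where G: "G 0 = G0" "\<And>n. link_chain K (\<epsilon> n) 0 1 a b (G n)" "\<And>n. G (Suc n) \<subseteq> G n"
    by blast
  have dec: "G n \<subseteq> G m" if "m \<le> n" for m n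
    using G(3) lift_Suc_antimono_le that by blast
  have Gsub: "G n \<subseteq> {0..1} \<times> K" for n
    using link_chain_subset[OF G(2) K] by blast
  have ex: "\<exists>x. \<forall>n. (t, x) \<in> G n" if t: "t \<in> {0..1}" for t
  proof -
    have cl: "closed {x. (t, x) \<in> G n}" for n
      using closed_vimage[OF link_chain_closed[OF G(2)], of "\<lambda>x. (t, x)"]
      by (simp add: vimage_def continuous_intros)
    have "K \<inter> (\<Inter>n\<in>UNIV. {x. (t, x) \<in> G n}) \<noteq> {}"
    proof (rule compact_imp_fip_image[OF assms(1) cl])
      fix I :: "nat set"
      assume "finite I" "I \<subseteq> UNIV"
      obtain x where x: "(t, x) \<in> G (Max (insert 0 I))"
        using link_chain_section[OF G(2) K t] by blast
      then have "x \<in> K" using Gsub by blast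
      moreover have "(t, x) \<in> G i" if "i \<in> I" for i
      proof -
        have "i \<le> Max (insert 0 I)"
          using that \<open>finite I\<close> by simp
        then show ?thesis using dec x by blast
      qed
      ultimately show "K \<inter> (\<Inter>n\<in>I. {x. (t, x) \<in> G n}) \<noteq> {}"
        by blast
    qed
    then show ?thesis by blast
  qed
  have uniq: "x = y" if "\<forall>n. (t, x) \<in> G n" "\<forall>n. (t, y) \<in> G n" for t x y
  proof (rule ccontr)
    assume "x \<noteq> y"
    then obtain n where "inverse (real (Suc n)) < dist x y / 2"
      by (metis half_gt_zero reals_Archimedean zero_less_dist_iff)
    moreover have "dist x y \<le> 2 * \<epsilon> n"
      using link_chain_diameter[OF G(2) K] that by blast
    ultimately show False
      by (simp add: \<epsilon>_def)
  qed
  obtain f where f: "\<And>t n. t \<in> {0..1} \<Longrightarrow> (t, f t) \<in> G n"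
    using ex by metis
  have graph: "(\<lambda>t. (t, f t)) ` {0..1} = (\<Inter>n. G n)"
  proof (intro subset_antisym subsetI)
    fix z assume "z \<in> (\<Inter>n. G n)"
    then have z: "(fst z, snd z) \<in> G n" for n by simp
    then have "fst z \<in> {0..1}" using Gsub by blast
    then show "z \<in> (\<lambda>t. (t, f t)) ` {0..1}"
      using uniq[of "fst z" "snd z" "f (fst z)"] z f by (metis image_eqI prod.collapse)
  qed (use f in auto)
  moreover have "compact (G 0)"
    using compact_Int_closed[OF compact_Times[OF compact_Icc assms(1)] link_chain_closed[OF G(2)]] Gsub[of 0]
    by (metis inf.absorb_iff2)
  ultimately have cpt: "compact ((\<lambda>t. (t, f t)) ` {0..1})"
    using compact_Int_closed[OF _ closed_INT[of UNIV G]] link_chain_closed[OF G(2)]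
    by (metis INF_lower UNIV_I inf.absorb_iff2)
  \<comment> \<open>A function with compact graph is continuous: preimages of closed sets are
    projections of compact pieces of the graph.\<close>
  have "continuous_on {0..1} f"
  proof (subst continuous_on_closed_vimage)
    show "\<forall>B. closed B \<longrightarrow> closed (f -` B \<inter> {0..1})"
    proof (intro allI impI)
      fix B :: "'b set" assume "closed B"
      have "f -` B \<inter> {0..1} = fst ` ((\<lambda>t. (t, f t)) ` {0..1} \<inter> UNIV \<times> B)"
        by force
      moreover have "compact ((\<lambda>t. (t, f t)) ` {0..1} \<inter> UNIV \<times> B)"
        using cpt \<open>closed B\<close> by (intro compact_Int_closed closed_Times) auto
      ultimately show "closed (f -` B \<inter> {0..1})"
        using compact_continuous_image[OF continuous_on_fst[OF continuous_on_id]] compact_imp_closed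
        by fastforce
    qed
  qed auto
  then have "path f" by (simp add: path_def)
  moreover have "path_image f \<subseteq> U"
    using f[of _ 0] G0(2) G(1) by (fastforce simp: path_image_def)
  moreover have "f 0 = a" "f 1 = b"
    using link_chain_diameter[OF G(2) K] uniq[of 0] uniq[of 1] f[of 0] f[of 1] by simp_all
  ultimately show ?thesis
    using that by (simp add: pathstart_def pathfinish_def)
qed

section \<open>Back and forth in separation trees\<close>

text \<open>\<open>E p a b\<close> stands for: \<open>a\<close> and \<open>b\<close> lie in the same component of the complement of \<open>p\<close>. It is false
  when \<open>p\<close> is one of \<open>a\<close>, \<open>b\<close>, so that \<open>\<not> E m a b\<close> says that \<open>m\<close> lies on the closed arc from \<open>a\<close> to
  \<open>b\<close>, and a relation preserving \<open>E\<close> is automatically injective.\<close>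

locale separation_tree =
  fixes P :: "'a set" and E :: "'a \<Rightarrow> 'a \<Rightarrow> 'a \<Rightarrow> bool"
  assumes E_dom: "E p a b \<Longrightarrow> a \<in> P \<and> b \<in> P"
    and E_irrefl: "\<not> E p p a"
    and E_refl: "a \<in> P \<Longrightarrow> a \<noteq> p \<Longrightarrow> E p a a"
    and E_sym: "E p a b \<Longrightarrow> E p b a"
    and E_trans: "E p a b \<Longrightarrow> E p b c \<Longrightarrow> E p a c"
    and E_switch: "p \<in> P \<Longrightarrow> q \<in> P \<Longrightarrow> a \<in> P \<Longrightarrow> p \<noteq> q \<Longrightarrow> E p a q \<or> E q a p"
    and E_centre: "a \<in> P \<Longrightarrow> b \<in> P \<Longrightarrow> c \<in> P \<Longrightarrow> \<exists>m\<in>P. \<not> E m a b \<and> \<not> E m b c \<and> \<not> E m a c"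
begin

definition centre :: "'a \<Rightarrow> 'a \<Rightarrow> 'a \<Rightarrow> 'a \<Rightarrow> bool" where
  "centre m a b c \<longleftrightarrow> \<not> E m a b \<and> \<not> E m b c \<and> \<not> E m a c"

definition classes :: "'a \<Rightarrow> 'a set set" where
  "classes p = (\<lambda>a. Collect (E p a)) ` (P - {p})"

definition ord :: "'a \<Rightarrow> enat" where
  "ord p = (if finite (classes p) then enat (card (classes p)) else \<infinity>)"

definition branch :: "'a set" where
  "branch = {p \<in> P. ord p \<ge> 3}"

definition centre_closed :: "'a set \<Rightarrow> bool" where
  "centre_closed F \<longleftrightarrow> (\<forall>a\<in>F. \<forall>b\<in>F. \<forall>c\<in>F. \<exists>m\<in>F. centre m a b c)"

text \<open>Closure under centres is asked of the domain only: preservation of \<open>E\<close>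
  transfers it to the range, so the notion is invariant under converse.\<close>

definition partial_iso :: "('a \<times> 'a) set \<Rightarrow> bool" where
  "partial_iso \<phi> \<longleftrightarrow> finite \<phi> \<and> \<phi> \<subseteq> branch \<times> branch \<and> (\<forall>p p'. (p, p') \<in> \<phi> \<longrightarrow> ord p = ord p') \<and>
     (\<forall>p p' a a' b b'. (p, p') \<in> \<phi> \<longrightarrow> (a, a') \<in> \<phi> \<longrightarrow> (b, b') \<in> \<phi> \<longrightarrow> (E p a b \<longleftrightarrow> E p' a' b')) \<and>
     centre_closed (Domain \<phi>)"

lemma E_comm: "E p a b \<longleftrightarrow> E p b a"
  using E_sym by blast

lemma E_irrefl': "\<not> E p a p"
  using E_irrefl E_sym by blast

lemma E_self: "a \<in> P \<Longrightarrow> E p a a \<longleftrightarrow> a \<noteq> p"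
  using E_refl E_irrefl by blast

lemma three_classes:
  assumes "3 \<le> ord p"
  obtains a b c where "a \<in> P - {p}" "b \<in> P - {p}" "c \<in> P - {p}" "\<not> E p a b" "\<not> E p b c" "\<not> E p a c"
proof -
  obtain T where T: "T \<subseteq> classes p" "card T = 3"
  proof (cases "finite (classes p)")
    case True
    then have "3 \<le> card (classes p)"
      using assms by (auto simp: ord_def numeral_eq_enat)
    then show ?thesis
      using obtain_subset_with_card_n that by metis
  next
    case False
    then show ?thesis
      using infinite_arbitrarily_large that by metis
  qed
  then obtain A B C where "T = {A, B, C}" "A \<noteq> B" "B \<noteq> C" "A \<noteq> C"
    using card_3_iff by metis
  moreover from this obtain a b c where abc: "a \<in> P - {p}" "b \<in> P - {p}" "c \<in> P - {p}" 
      "A = Collect (E p a)" "B = Collect (E p b)" "C = Collect (E p c)"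
    using T(1) by (auto simp: classes_def)
  moreover have eq: "Collect (E p x) = Collect (E p y)" if "E p x y" for x y
    using that E_sym E_trans by blast
  ultimately have "\<not> E p a b" "\<not> E p b c" "\<not> E p a c"
    by metis+
  then show ?thesis
    by (rule that[OF abc(1-3)])
qed

lemma branchI:
  assumes "p \<in> P" "a \<in> P - {p}" "b \<in> P - {p}" "c \<in> P - {p}"
    and ne: "\<not> E p a b" "\<not> E p b c" "\<not> E p a c"
  shows "p \<in> branch"
proof -
  have "E p a a" "E p b b" "E p c c" using assms E_refl by blast+
  then have "card {Collect (E p a), Collect (E p b), Collect (E p c)} = 3"
    using ne E_comm by (subst card_3_iff) (metis mem_Collect_eq)
  moreover have "{Collect (E p a), Collect (E p b), Collect (E p c)} \<subseteq> classes p"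
    using assms by (auto simp: classes_def)
  ultimately have "finite (classes p) \<Longrightarrow> 3 \<le> card (classes p)"
    by (metis card_mono)
  then show ?thesis
    using assms(1) by (auto simp: branch_def ord_def numeral_eq_enat)
qed

section \<open>Centres of triples and gates onto finite sets\<close>

lemma centre_swap: "centre m a b c \<longleftrightarrow> centre m b a c" "centre m a b c \<longleftrightarrow> centre m a c b"
  unfolding centre_def using E_comm by blast+

text \<open>If \<open>m\<close> and \<open>n\<close> differ, each of the three points is on the side
  of \<open>n\<close> seen from \<open>m\<close>, or on the side of \<open>m\<close> seen from
  \<open>n\<close>. Two of the three share the alternative and so lie in one class, which a centre
  forbids.\<close>

lemma centre_unique:
  assumes "a \<in> P" "b \<in> P" "c \<in> P" "m \<in> P" "n \<in> P" "centre m a b c" "centre n a b c"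
  shows "m = n"
proof (rule ccontr)
  assume "m \<noteq> n"
  then have "\<And>x. x \<in> P \<Longrightarrow> E m x n \<or> E n x m"
    using E_switch assms by blast
  then show False
    using assms E_sym E_trans unfolding centre_def by meson
qed

lemma between_trans:
  assumes "\<not> E m c r" "\<not> E r c f" "c \<in> P" "f \<in> P" "m \<in> P" "r \<in> P"
  shows "\<not> E m c f"
proof (cases "m = r")
  case False
  then show ?thesis
    using E_switch[of r m c] E_switch[of r m f] assms E_sym E_trans by metis
qed (use assms in auto)

text \<open>\<open>r\<close> is the point of the convex hull of \<open>F\<close> nearest to \<open>c\<close>.\<close>

lemma gate_exists:
  assumes "finite F" "F \<noteq> {}" "F \<subseteq> P" "c \<in> P"
  shows "\<exists>r\<in>P. (\<forall>f\<in>F. \<not> E r c f) \<and> (\<exists>a\<in>F. \<exists>b\<in>F. \<not> E r a b)"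
  using assms(1-3)
proof (induction rule: finite_ne_induct)
  case (singleton a)
  then show ?case
    using E_irrefl E_irrefl' by blast
next
  case (insert b F)
  then obtain r u v where r: "r \<in> P" "\<forall>f\<in>F. \<not> E r c f" "u \<in> F" "v \<in> F" "\<not> E r u v"
    by auto
  \<comment> \<open>The new gate is the centre of \<open>c\<close>, the old gate \<open>r\<close>
    and the added point \<open>b\<close>.\<close>
  then obtain m where m: "m \<in> P" "\<not> E m c r" "\<not> E m r b" "\<not> E m c b"
    using E_centre[of c r b] insert assms by auto
  have "\<not> E m c f" if "f \<in> F" for f
    using between_trans[of m c r f] m r that insert assms by blast
  \<comment> \<open>That \<open>m\<close> is in the new hull is witnessed by \<open>b\<close> and
    one of \<open>u\<close>, \<open>v\<close>; otherwise \<open>u\<close> and \<open>v\<close> would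
    be on the same side of \<open>r\<close>, which lies between them.\<close>
  moreover have "\<not> E m u b \<or> \<not> E m v b"
  proof (rule ccontr)
    assume c: "\<not> (\<not> E m u b \<or> \<not> E m v b)"
    then have "r \<noteq> m"
      using m r E_sym E_trans by blast
    then have "E r u m \<or> E m u r" "E r v m \<or> E m v r"
      using E_switch m r insert by blast+
    then show False
      using c m(3) r(5) E_sym E_trans by meson
  qed
  ultimately show ?case
    using m r by blast
qed

section \<open>Finite partial isomorphisms\<close>

lemma partial_isoD:
  assumes "partial_iso \<phi>"
  shows "finite \<phi>" "finite (Domain \<phi>)" "Domain \<phi> \<subseteq> branch" "Range \<phi> \<subseteq> branch" "Domain \<phi> \<subseteq> P" "Range \<phi> \<subseteq> P"
    "centre_closed (Domain \<phi>)"
proof -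
  show "finite \<phi>" "centre_closed (Domain \<phi>)" and *: "Domain \<phi> \<subseteq> branch" "Range \<phi> \<subseteq> branch"
    using assms unfolding partial_iso_def by blast+
  then show "finite (Domain \<phi>)" "Domain \<phi> \<subseteq> P" "Range \<phi> \<subseteq> P"
    by (auto simp: finite_Domain branch_def)
qed

lemma partial_iso_ord: "partial_iso \<phi> \<Longrightarrow> (p, p') \<in> \<phi> \<Longrightarrow> ord p = ord p'"
  unfolding partial_iso_def by blast

lemma partial_iso_E:
  "partial_iso \<phi> \<Longrightarrow> (p, p') \<in> \<phi> \<Longrightarrow> (a, a') \<in> \<phi> \<Longrightarrow> (b, b') \<in> \<phi> \<Longrightarrow> E p a b \<longleftrightarrow> E p' a' b'"
  unfolding partial_iso_def by blast

lemma partial_isoI: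
  assumes "finite \<phi>" "\<phi> \<subseteq> branch \<times> branch" "centre_closed (Domain \<phi>)"
    "\<And>p p'. (p, p') \<in> \<phi> \<Longrightarrow> ord p = ord p'"
    "\<And>p p' a a' b b'. (p, p') \<in> \<phi> \<Longrightarrow> (a, a') \<in> \<phi> \<Longrightarrow> (b, b') \<in> \<phi> \<Longrightarrow> E p a b \<longleftrightarrow> E p' a' b'"
  shows "partial_iso \<phi>"
  unfolding partial_iso_def using assms by (intro conjI allI impI) auto

lemma partial_iso_converse:
  assumes "partial_iso \<phi>"
  shows "partial_iso (\<phi>\<inverse>)"
proof -
  have "centre_closed (Range \<phi>)"
    unfolding centre_closed_def
  proof (intro ballI)
    fix a' b' c' assume "a' \<in> Range \<phi>" "b' \<in> Range \<phi>" "c' \<in> Range \<phi>"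
    then obtain a b c where abc: "(a, a') \<in> \<phi>" "(b, b') \<in> \<phi>" "(c, c') \<in> \<phi>" by blast
    then obtain m m' where "(m, m') \<in> \<phi>" "centre m a b c"
      using partial_isoD(7)[OF assms] unfolding centre_closed_def by blast
    moreover from this have "centre m' a' b' c'"
      using abc partial_iso_E[OF assms] unfolding centre_def by blast
    ultimately show "\<exists>m\<in>Range \<phi>. centre m a' b' c'" by blast
  qed
  then show ?thesis
    using partial_isoD[OF assms] partial_iso_ord[OF assms] partial_iso_E[OF assms]
    by (intro partial_isoI) (auto simp: Domain_converse)
qed

lemma partial_iso_eq:
  assumes "partial_iso \<phi>" "(a, a') \<in> \<phi>" "(b, b') \<in> \<phi>"
  shows "a = b \<longleftrightarrow> a' = b'"
  using partial_iso_E[OF assms(1) assms(2) assms(3) assms(3)] assms partial_isoD(5,6)[OF assms(1)]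
    E_self[of b a] E_self[of b' a'] by blast

text \<open>Only relations that involve the new point need checking. In \<open>ii\<close> a single
  witness \<open>w\<close> suffices, because \<open>E f\<close> is transitive: comparing
  \<open>c\<close> with \<open>w\<close> and \<open>w\<close> with \<open>g\<close> decides
  \<open>E f c g\<close> for every \<open>g\<close>, and likewise for the images.\<close>

lemma partial_iso_insert:
  assumes \<phi>: "partial_iso \<phi>" and c: "c \<in> branch" "c' \<in> branch" "ord c = ord c'"
    and cc: "\<And>f g. f \<in> Domain \<phi> \<Longrightarrow> g \<in> Domain \<phi> \<Longrightarrow> \<exists>m\<in>insert c (Domain \<phi>). centre m c f g"
    and new: "c \<notin> Domain \<phi>"
    and i: "\<And>f f' g g'. (f, f') \<in> \<phi> \<Longrightarrow> (g, g') \<in> \<phi> \<Longrightarrow> E c f g \<longleftrightarrow> E c' f' g'"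
    and ii: "\<And>f f'. (f, f') \<in> \<phi> \<Longrightarrow>
               (\<forall>(g, g')\<in>\<phi>. \<not> E f c g \<and> \<not> E f' c' g') \<or> (\<exists>(w, w')\<in>\<phi>. E f c w \<and> E f' c' w')"
  shows "partial_iso (insert (c, c') \<phi>)"
proof -
  have P: "c \<in> P" "c' \<in> P" using c by (auto simp: branch_def)
  have ii': "E f c g \<longleftrightarrow> E f' c' g'" if "(f, f') \<in> \<phi>" "(g, g') \<in> \<phi>" for f f' g g'
    using ii[OF that(1)]
  proof
    assume "\<exists>(w, w')\<in>\<phi>. E f c w \<and> E f' c' w'"
    then obtain w w' where w: "(w, w') \<in> \<phi>" "E f c w" "E f' c' w'" by blast
    then have "E f w g \<longleftrightarrow> E f' w' g'"
      using partial_iso_E[OF \<phi>] that by blast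
    then show ?thesis
      using w E_sym E_trans by meson
  qed (use that in blast)
  then have ii'': "E f g c \<longleftrightarrow> E f' g' c'" if "(f, f') \<in> \<phi>" "(g, g') \<in> \<phi>" for f f' g g'
    using E_comm that by blast
  have new': "c' \<noteq> f'" if "(f, f') \<in> \<phi>" for f f'
  proof
    assume "c' = f'"
    then have "\<not> E c f f"
      using i that E_irrefl by blast
    then show False
      using new that partial_isoD(5)[OF \<phi>] E_refl[of f c] by blast
  qed
  have ff: "E f c c" "E f' c' c'" if "(f, f') \<in> \<phi>" for f f'
  proof -
    have "f \<noteq> c" "c' \<noteq> f'"
      using new new' that by blast+
    then show "E f c c" "E f' c' c'"
      using P E_refl by simp_all
  qed
  have EE: "E p a b \<longleftrightarrow> E p' a' b'"
    if "(p, p') \<in> insert (c, c') \<phi>" "(a, a') \<in> insert (c, c') \<phi>" "(b, b') \<in> insert (c, c') \<phi>"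
    for p p' a a' b b'
  proof -
    have cases: "x = c \<and> x' = c' \<or> (x, x') \<in> \<phi>" if "(x, x') \<in> insert (c, c') \<phi>" for x x'
      using that by blast
    show ?thesis
      using cases[OF that(1)] cases[OF that(2)] cases[OF that(3)]
      by (elim disjE conjE) (simp_all add: E_irrefl E_irrefl' ff i ii' ii'' partial_iso_E[OF \<phi>])
  qed
  have "\<exists>m\<in>insert c (Domain \<phi>). centre m x y z"
    if "x \<in> insert c (Domain \<phi>)" "y \<in> insert c (Domain \<phi>)" "z \<in> insert c (Domain \<phi>)" for x y z
  proof -
    have "centre c c c u" for u
      by (simp add: centre_def E_irrefl E_irrefl')
    moreover have "\<exists>m\<in>Domain \<phi>. centre m x y z" if "x \<in> Domain \<phi>" "y \<in> Domain \<phi>" "z \<in> Domain \<phi>"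
      using partial_isoD(7)[OF \<phi>] that by (auto simp: centre_closed_def)
    moreover have "\<exists>m\<in>insert c (Domain \<phi>). centre m x' c z'" "\<exists>m\<in>insert c (Domain \<phi>). centre m x' z' c"
      if "x' \<in> Domain \<phi>" "z' \<in> Domain \<phi>" for x' z'
      using cc[OF that] centre_swap by blast+
    moreover have "centre c u c c" "centre c c u c" for u
      by (simp_all add: centre_def E_irrefl E_irrefl')
    ultimately show ?thesis
      using that cc centre_swap by (elim insertE) blast+
  qed
  then have "centre_closed (Domain (insert (c, c') \<phi>))"
    by (simp add: centre_closed_def)
  then show ?thesis
    using EE partial_isoD(1,3,4)[OF \<phi>] partial_iso_ord[OF \<phi>] c
    by (intro partial_isoI) auto
qed

end

locale coloured_tree = separation_tree +
  fixes S :: "enat set"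
  assumes S_ge: "n \<in> S \<Longrightarrow> n \<ge> 3"
    and branch_S: "p \<in> branch \<Longrightarrow> ord p \<in> S"
    and S_dense: "a \<in> P \<Longrightarrow> b \<in> P \<Longrightarrow> a \<noteq> b \<Longrightarrow> n \<in> S \<Longrightarrow> 
                    \<exists>p\<in>P. \<not> E p a b \<and> p \<noteq> a \<and> p \<noteq> b \<and> ord p = n"
begin

section \<open>One-point extensions of partial isomorphisms\<close>

lemma centre_closedD:
  "centre_closed F \<Longrightarrow> a \<in> F \<Longrightarrow> b \<in> F \<Longrightarrow> c \<in> F \<Longrightarrow> \<exists>m\<in>F. centre m a b c"
  by (simp add: centre_closed_def)

lemma ord_dense:
  assumes "a \<in> P" "b \<in> P" "a \<noteq> b" "c \<in> branch"
  obtains p where "p \<in> branch" "\<not> E p a b" "p \<noteq> a" "p \<noteq> b" "ord p = ord c"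
proof -
  obtain p where "p \<in> P" "\<not> E p a b" "p \<noteq> a" "p \<noteq> b" "ord p = ord c"
    using S_dense[OF assms(1-3) branch_S[OF assms(4)]] by blast
  then show ?thesis
    using that assms(4) by (auto simp: branch_def)
qed

text \<open>The gate \<open>r\<close> of \<open>c\<close> onto the part of \<open>F\<close> on the
  side of \<open>a\<close> lies between two points \<open>u\<close>, \<open>v\<close> of that part,
  and between each of them and \<open>b\<close>, since \<open>c\<close> separates them from
  \<open>b\<close>. So \<open>r\<close> is the centre of \<open>u\<close>, \<open>v\<close>,
  \<open>b\<close> and belongs to \<open>F\<close>.\<close>

lemma gate_in_centre_closed:
  assumes "finite F" "F \<subseteq> P" "centre_closed F" "c \<in> P" "c \<notin> F" "a \<in> F" "b \<in> F" "\<not> E c a b"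
  obtains r where "r \<in> F" "E c r a" "\<And>f. f \<in> F \<Longrightarrow> E c f a \<Longrightarrow> \<not> E r c f"
proof -
  let ?F = "{f \<in> F. E c f a}"
  have "a \<in> P" "a \<noteq> c" using assms by blast+
  then have "?F \<noteq> {}" using E_refl[of a c] \<open>a \<in> F\<close> by blast
  moreover have "finite ?F" "?F \<subseteq> P" using assms by auto
  ultimately have "\<exists>r\<in>P. (\<forall>f\<in>?F. \<not> E r c f) \<and> (\<exists>u\<in>?F. \<exists>v\<in>?F. \<not> E r u v)"
    using gate_exists[of ?F c] \<open>c \<in> P\<close> by simp
  then obtain r u v where r: "r \<in> P" "\<forall>f\<in>?F. \<not> E r c f" "u \<in> ?F" "v \<in> ?F" "\<not> E r u v"
    by blast
  have "\<not> E c w b" if "w \<in> ?F" for w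
    using that assms E_sym E_trans by blast
  then have "\<not> E r u b" "\<not> E r v b"
    using between_trans[of r u c b] between_trans[of r v c b] r assms E_comm by blast+
  then have "centre r u v b"
    using r by (simp add: centre_def)
  moreover obtain n where "n \<in> F" "centre n u v b"
    using centre_closedD[OF assms(3), of u v b] assms r by blast
  ultimately have "r \<in> F"
    using centre_unique[of u v b r n] r assms by blast
  then have "r \<noteq> c" using assms by blast
  then have "E c u r"
    using E_switch[of r c u] r assms E_comm by blast
  then have "E c r a"
    using r E_sym E_trans by blast
  then show ?thesis
    using that r \<open>r \<in> F\<close> by blast
qed

text \<open>Here \<open>c\<close> lies on an edge of the hull of the domain. Its nearest points
  \<open>u\<close>, \<open>v\<close> on the two sides determine all its relations to the domain, so
  any point of the right order strictly between the images of \<open>u\<close> and \<open>v\<close>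
  can serve as \<open>c'\<close>.\<close>

lemma insert_between:
  assumes \<phi>: "partial_iso \<phi>" and c: "c \<in> branch" "c \<notin> Domain \<phi>"
    and ab: "a \<in> Domain \<phi>" "b \<in> Domain \<phi>" "\<not> E c a b"
  shows "\<exists>c'. partial_iso (insert (c, c') \<phi>)"
proof -
  let ?F = "Domain \<phi>"
  note D = partial_isoD[OF \<phi>]
  have cP: "c \<in> P" using c by (simp add: branch_def)
  \<comment> \<open>A domain point in a third direction would make \<open>c\<close> the centre of
    three domain points, hence a member of the domain.\<close>
  have sides: "E c f a \<or> E c f b" if f: "f \<in> ?F" for f
  proof (rule ccontr)
    assume "\<not> (E c f a \<or> E c f b)"
    then have "centre c f a b" using ab by (simp add: centre_def)
    moreover obtain n where "n \<in> ?F" "centre n f a b"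
      using centre_closedD[OF D(7) f ab(1,2)] by blast
    ultimately have "c = n"
      using centre_unique[of f a b c n] D(5) cP ab f by blast
    then show False
      using c \<open>n \<in> ?F\<close> by blast
  qed
  obtain u where u: "u \<in> ?F" "E c u a" "\<And>f. f \<in> ?F \<Longrightarrow> E c f a \<Longrightarrow> \<not> E u c f"
    using gate_in_centre_closed[OF D(2,5,7) cP c(2) ab] by blast
  obtain v where v: "v \<in> ?F" "E c v b" "\<And>f. f \<in> ?F \<Longrightarrow> E c f b \<Longrightarrow> \<not> E v c f"
    using gate_in_centre_closed[OF D(2,5,7) cP c(2) ab(2,1)] ab(3) E_comm by blast
  have uv: "\<not> E c u v" 
    using u v ab E_sym E_trans by meson
  then have "u \<noteq> v"
    using u(2) E_sym[OF u(2)] E_trans by blast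
  obtain u' v' where uv': "(u, u') \<in> \<phi>" "(v, v') \<in> \<phi>"
    using u v by blast
  have "u' \<in> P" "v' \<in> P" "u' \<noteq> v'"
    using uv' D(6) partial_iso_eq[OF \<phi> uv'] \<open>u \<noteq> v\<close> by auto
  then obtain c' where c': "c' \<in> branch" "\<not> E c' u' v'" "c' \<noteq> u'" "c' \<noteq> v'" "ord c' = ord c"
    using ord_dense[of u' v' c] c(1) by blast
  have c'P: "c' \<in> P" using c' by (simp add: branch_def)
  \<comment> \<open>Formulated with \<open>x\<close>, \<open>y\<close>, \<open>a'\<close> so as to
    apply to \<open>u\<close>, \<open>v\<close>, \<open>a\<close> and to \<open>v\<close>,
    \<open>u\<close>, \<open>b\<close>. Seen from \<open>f\<close>, the new point is on the side of
    \<open>x\<close>, or of \<open>y\<close> if \<open>f\<close> is \<open>x\<close> itself; this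
    provides the witness \<open>w\<close> for the insertion.\<close>
  have side: "E c' f' x' \<and> (f = x \<longrightarrow> E f c y \<and> E f' c' y') \<and> (f \<noteq> x \<longrightarrow> E f c x \<and> E f' c' x')"
    if x: "x \<in> ?F" "E c x a'" "\<And>f. f \<in> ?F \<Longrightarrow> E c f a' \<Longrightarrow> \<not> E x c f" 
      and y: "y \<in> ?F" "(x, x') \<in> \<phi>" "(y, y') \<in> \<phi>" "\<not> E c x y" "x \<noteq> y" "\<not> E c' x' y'" "c' \<noteq> x'" "c' \<noteq> y'"
      and f: "(f, f') \<in> \<phi>" "E c f a'" for x x' y y' f f' a'
  proof -
    have fP: "f \<in> P" "f' \<in> P" "x \<in> P" "x' \<in> P" "y \<in> P" "y' \<in> P" 
      using f y D(5,6) by blast+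
    have xcy: "E x c y" "E x' c' y'"
      using E_switch[of c x y] E_switch[of c' x' y'] x y fP cP c'P c E_comm by blast+
    have "\<not> E x f c"
      using x f E_comm by blast
    then have "\<not> E x f y"
      using E_trans E_sym xcy by blast
    then have "\<not> E x' f' y'"
      using partial_iso_E[OF \<phi>] f y by blast
    then have nx: "\<not> E x' c' f'"
      using E_trans E_sym xcy by blast
    have "E c' f' x'"
      using E_switch[of c' x' f'] nx fP c'P y E_comm by blast
    moreover have "E f c x \<and> E f' c' x'" if "f \<noteq> x"
    proof -
      have "f' \<noteq> x'"
        using that partial_iso_eq[OF \<phi> f(1) y(2)] by blast
      then show ?thesis
        using that E_switch[of x f c] E_switch[of x' f' c'] nx \<open>\<not> E x f c\<close> fP cP c'P E_comm by blast
    qed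
    moreover have "f = x \<Longrightarrow> f' = x'"
      using partial_iso_eq[OF \<phi> f(1) y(2)] by blast
    ultimately show ?thesis
      using xcy by blast
  qed
  have sideu: "E c' f' u' \<and> (f = u \<longrightarrow> E f c v \<and> E f' c' v') \<and> (f \<noteq> u \<longrightarrow> E f c u \<and> E f' c' u')"
    if "(f, f') \<in> \<phi>" "E c f a" for f f'
    using side[OF u v(1) uv' uv \<open>u \<noteq> v\<close> c'(2-4) that] .
  have sidev: "E c' f' v' \<and> (f = v \<longrightarrow> E f c u \<and> E f' c' u') \<and> (f \<noteq> v \<longrightarrow> E f c v \<and> E f' c' v')"
    if "(f, f') \<in> \<phi>" "E c f b" for f f'
    using side[OF v u(1) uv'(2,1) _ \<open>u \<noteq> v\<close>[symmetric] _ c'(4,3) that] uv c'(2) E_comm by blast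
  have "partial_iso (insert (c, c') \<phi>)"
  proof (rule partial_iso_insert[OF \<phi> c(1) c'(1) c'(5)[symmetric] _ c(2)])
    fix f g assume fg: "f \<in> ?F" "g \<in> ?F"
    \<comment> \<open>If \<open>f\<close> and \<open>g\<close> are on the same side of
      \<open>c\<close>, then \<open>c\<close> may be replaced by any domain point \<open>y\<close>
      on the other side without changing the centre with \<open>f\<close> and
      \<open>g\<close>.\<close>
    have same: "\<exists>m\<in>?F. centre m c f g" if xy: "E c f x" "E c g x" and y: "y \<in> ?F" and "\<not> E c x y" for x y
    proof -
      obtain m where m: "m \<in> ?F" "centre m y f g"
        using centre_closedD[OF D(7) y fg] by blast
      then have "m \<noteq> c" using c by blast
      have yP: "y \<in> P" "f \<in> P" "g \<in> P" "m \<in> P" using fg m that D(5) by blast+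
      have ny: "\<not> E c f y" "\<not> E c g y" 
        using that E_sym E_trans by blast+
      have "\<not> E m c f \<and> \<not> E m c g"
      proof (rule ccontr)
        assume as: "\<not> (\<not> E m c f \<and> \<not> E m c g)"
        then have "\<not> E m c y"
          using m E_sym E_trans unfolding centre_def by blast
        then have "E c y m"
          using E_switch[of c m y] \<open>m \<noteq> c\<close> yP cP E_comm by blast
        then have "\<not> E c f m" "\<not> E c g m"
          using ny E_sym E_trans by blast+
        then have "E m f c" "E m g c"
          using E_switch[of c m f] E_switch[of c m g] \<open>m \<noteq> c\<close> yP cP by blast+
        then show False
          using m E_sym E_trans unfolding centre_def by blast
      qed
      then show ?thesis
        using m by (auto simp: centre_def)
    qed
    show "\<exists>m\<in>insert c ?F. centre m c f g"
    proof (cases "E c f g")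
      case False
      then have "centre c c f g" by (simp add: centre_def E_irrefl)
      then show ?thesis by blast
    next
      case True
      have "E c f a \<Longrightarrow> E c g a" "E c f b \<Longrightarrow> E c g b"
        using True E_sym E_trans by blast+
      then show ?thesis
        using sides[OF fg(1)] same[of a b] same[of b a] ab E_comm by blast
    qed
  next
    fix f f' g g' assume fg: "(f, f') \<in> \<phi>" "(g, g') \<in> \<phi>"
    have s: "E c f a \<or> E c f b" "E c g a \<or> E c g b"
      using sides fg by blast+
    show "E c f g \<longleftrightarrow> E c' f' g'"
    proof -
      have a: "E c f g \<and> E c' f' g'" if "E c f a" "E c g a"
        using sideu[OF fg(1)] sideu[OF fg(2)] that E_sym E_trans by blast
      have b: "E c f g \<and> E c' f' g'" if "E c f b" "E c g b"
        using sidev[OF fg(1)] sidev[OF fg(2)] that E_sym E_trans by blast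
      have ab1: "\<not> E c f g" if "E c f a \<and> E c g b \<or> E c f b \<and> E c g a"
        using that ab(3) E_sym E_trans by meson
      have ab2: "\<not> E c' f' g'" if "E c f a \<and> E c g b \<or> E c f b \<and> E c g a"
      proof
        assume "E c' f' g'"
        moreover have "E c' f' u' \<and> E c' g' v' \<or> E c' f' v' \<and> E c' g' u'"
          using that sideu[OF fg(1)] sideu[OF fg(2)] sidev[OF fg(1)] sidev[OF fg(2)] by blast
        ultimately show False
          using c'(2) E_sym E_trans by meson
      qed
      show ?thesis
        using s a b ab1 ab2 by blast
    qed
  next
    fix f f' assume f: "(f, f') \<in> \<phi>"
    then show "(\<forall>(g, g')\<in>\<phi>. \<not> E f c g \<and> \<not> E f' c' g') \<or> (\<exists>(w, w')\<in>\<phi>. E f c w \<and> E f' c' w')"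
      using sides[of f] sideu[OF f] sidev[OF f] uv' by blast
  qed
  then show ?thesis by blast
qed

text \<open>A count: the class of \<open>c\<close> at \<open>r\<close> is missed by the domain, the
  range meets at most as many classes at \<open>r'\<close> as the domain does at \<open>r\<close>,
  and both points have the same order. Since only finitely many classes are met, a class at
  \<open>r'\<close> stays free, also when the order is infinite.\<close>

lemma free_class:
  assumes \<phi>: "partial_iso \<phi>" and r: "(r, r') \<in> \<phi>" and c: "c \<in> P" "c \<noteq> r" "\<And>f. f \<in> Domain \<phi> \<Longrightarrow> \<not> E r c f"
  obtains d where "d \<in> P" "d \<noteq> r'" "\<And>f. f \<in> Range \<phi> \<Longrightarrow> \<not> E r' d f"
proof -
  note D = partial_isoD[OF \<phi>]
  define K where "K = (\<lambda>f. Collect (E r f)) ` (Domain \<phi> - {r})"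
  define K' where "K' = (\<lambda>f. Collect (E r' f)) ` (Range \<phi> - {r'})"
  have fin: "finite K" "finite K'"
    using D(2) \<open>finite \<phi>\<close> by (auto simp: K_def K'_def finite_Range)
  have Kc: "K \<subseteq> classes r" "K' \<subseteq> classes r'"
    using D(5,6) by (auto simp: K_def K'_def classes_def)
  have eq: "Collect (E p x) = Collect (E p y) \<longleftrightarrow> E p x y" if "x \<in> P" "y \<in> P" "x \<noteq> p" for p x y
    using that E_refl E_sym E_trans by (metis mem_Collect_eq Collect_cong)
  have neq: "f = r \<longleftrightarrow> f' = r'" if "(f, f') \<in> \<phi>" for f f'
    using partial_iso_eq[OF \<phi> that r] .
  have "Collect (E r c) \<in> classes r"
    using c by (auto simp: classes_def)
  moreover have "Collect (E r c) \<notin> K"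
    using c eq[of c _ r] D(5) unfolding K_def by blast
  ultimately have K: "K \<subset> classes r" using Kc by blast
  have "card K' \<le> card K"
  proof -
    define h where "h f = (SOME f'. (f, f') \<in> \<phi>)" for f
    have h: "(f, h f) \<in> \<phi>" if "f \<in> Domain \<phi>" for f
      using that someI_ex unfolding h_def by (metis Domain.cases)
    have hK: "E r f g \<longleftrightarrow> E r' (h f) (h g)" if "f \<in> Domain \<phi>" "g \<in> Domain \<phi>" for f g
      using partial_iso_E[OF \<phi> r h h] that by blast
    \<comment> \<open>Sends the class of a domain point at \<open>r\<close> to the class of its
      image at \<open>r'\<close>, by way of a chosen representative; it maps \<open>K\<close> onto
      \<open>K'\<close>.\<close>
    define T where "T = (\<lambda>C. Collect (E r' (h (SOME f. f \<in> Domain \<phi> - {r} \<and> Collect (E r f) = C))))"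
    have T: "T (Collect (E r f)) = Collect (E r' (h f))" if f: "f \<in> Domain \<phi> - {r}" for f
    proof -
      define g where "g = (SOME g. g \<in> Domain \<phi> - {r} \<and> Collect (E r g) = Collect (E r f))"
      have g: "g \<in> Domain \<phi> - {r}" "Collect (E r g) = Collect (E r f)"
        unfolding g_def using someI[of "\<lambda>g. g \<in> Domain \<phi> - {r} \<and> Collect (E r g) = Collect (E r f)" f] f
        by blast+
      then have "E r g f"
        using eq[of g f r] f D(5) by blast
      then have "E r' (h g) (h f)"
        using hK f g by blast
      then show ?thesis
        using eq[of "h g" "h f" r'] E_dom[of r' "h g" "h f"] E_irrefl[of r' "h f"]
        unfolding T_def g_def by blast
    qed
    have "K' \<subseteq> T ` K"
    proof
      fix C assume "C \<in> K'"
      then obtain f f' where f: "(f, f') \<in> \<phi>" "f' \<noteq> r'" "C = Collect (E r' f')"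
        by (auto simp: K'_def)
      then have "f \<in> Domain \<phi> - {r}" "h f = f'"
        using neq partial_iso_eq[OF \<phi> f(1) h[of f]] by blast+
      then show "C \<in> T ` K"
        using T f by (force simp: K_def)
    qed
    then show ?thesis
      using fin(1) by (rule surj_card_le[rotated])
  qed
  \<comment> \<open>Equality would make the common order finite, with
    \<open>card (classes r) = card K' \<le> card K\<close>, against the strict inclusion of
    \<open>K\<close>.\<close>
  have "K' \<noteq> classes r'"
  proof
    assume K': "K' = classes r'"
    then have "ord r = enat (card K')"
      using fin partial_iso_ord[OF \<phi> r] by (simp add: ord_def)
    then have "finite (classes r)" "card (classes r) = card K'"
      by (auto simp: ord_def split: if_splits)
    then show False
      using psubset_card_mono[OF _ K] \<open>card K' \<le> card K\<close> by simp
  qed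
  then obtain d where d: "d \<in> P" "d \<noteq> r'" "Collect (E r' d) \<notin> K'"
    using Kc by (auto simp: classes_def)
  have "\<not> E r' d f" if "f \<in> Range \<phi>" for f
  proof
    assume "E r' d f"
    then have "f \<noteq> r'" "Collect (E r' d) = Collect (E r' f)"
      using E_irrefl' eq[of d f r'] d E_dom by blast+
    then show False
      using d that by (auto simp: K'_def)
  qed
  then show ?thesis
    using that d by blast
qed

lemma insert_end:
  assumes \<phi>: "partial_iso \<phi>" and c: "c \<in> branch" "c \<notin> Domain \<phi>" 
    and r: "r \<in> Domain \<phi>" "\<And>f. f \<in> Domain \<phi> \<Longrightarrow> \<not> E r c f"
  shows "\<exists>c'. partial_iso (insert (c, c') \<phi>)"
proof -
  note D = partial_isoD[OF \<phi>]
  have cP: "c \<in> P" "c \<noteq> r" using c r by (auto simp: branch_def)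
  obtain r' where r': "(r, r') \<in> \<phi>" using r by blast
  then have rP: "r \<in> P" "r' \<in> P" using D by blast+
  obtain d where d: "d \<in> P" "d \<noteq> r'" "\<And>f. f \<in> Range \<phi> \<Longrightarrow> \<not> E r' d f"
    using free_class[OF \<phi> r' cP r(2)] by blast
  \<comment> \<open>The point \<open>d\<close> only names a free class and may have the wrong order;
    density between \<open>r'\<close> and \<open>d\<close> gives a point of order
    \<open>ord c\<close> in the same class.\<close>
  obtain c' where c': "c' \<in> branch" "\<not> E c' r' d" "c' \<noteq> r'" "c' \<noteq> d" "ord c' = ord c"
    using ord_dense[OF rP(2) d(1) _ c(1)] d(2) by blast
  have c'P: "c' \<in> P" using c' by (simp add: branch_def)
  have "E r' d c'"
    using E_switch[of r' c' d] E_comm c' c'P d rP by blast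
  then have r'c': "\<not> E r' c' f" if "f \<in> Range \<phi>" for f
    using d(3)[OF that] E_trans by blast
  have f: "E c f r" "E c' f' r'" "f \<noteq> r \<Longrightarrow> E f c r" "f \<noteq> r \<Longrightarrow> E f' c' r'" if "(f, f') \<in> \<phi>" for f f'
  proof -
    have n: "\<not> E r c f" "\<not> E r' c' f'" and fP: "f \<in> P" "f' \<in> P"
      using that r r'c' D by blast+
    show "E c f r" "E c' f' r'"
      using E_switch[of r c f] E_switch[of r' c' f'] n cP c' c'P rP fP E_comm by blast+
    assume "f \<noteq> r"
    then have "f' \<noteq> r'"
      using partial_iso_eq[OF \<phi> that r'] by blast
    show "E f c r" "E f' c' r'"
      using E_switch[of r f c] E_switch[of r' f' c'] n \<open>f \<noteq> r\<close> \<open>f' \<noteq> r'\<close> cP c' c'P rP fP E_comm by blast+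
  qed
  have "partial_iso (insert (c, c') \<phi>)"
  proof (rule partial_iso_insert[OF \<phi> c(1) c'(1) c'(5)[symmetric] _ c(2)])
    fix f g assume fg: "f \<in> Domain \<phi>" "g \<in> Domain \<phi>"
    then obtain m where m: "m \<in> Domain \<phi>" "centre m r f g"
      using centre_closedD[OF D(7) r(1) fg] by blast
    have "f \<in> P" "g \<in> P" "m \<in> P" using fg m D by blast+
    then have "\<not> E m f c" "\<not> E m g c"
      using m between_trans[of m f r c] between_trans[of m g r c] r(2)[OF fg(1)] r(2)[OF fg(2)] rP cP E_comm
      unfolding centre_def by blast+
    then show "\<exists>m\<in>insert c (Domain \<phi>). centre m c f g"
      using m E_comm unfolding centre_def by blast
  next
    fix f f' g g' assume fg: "(f, f') \<in> \<phi>" "(g, g') \<in> \<phi>"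
    show "E c f g \<longleftrightarrow> E c' f' g'"
      using f(1,2)[OF fg(1)] f(1,2)[OF fg(2)] E_sym E_trans by blast
  next
    fix h h' assume h: "(h, h') \<in> \<phi>"
    show "(\<forall>(g, g')\<in>\<phi>. \<not> E h c g \<and> \<not> E h' c' g') \<or> (\<exists>(w, w')\<in>\<phi>. E h c w \<and> E h' c' w')"
    proof (cases "h = r")
      case True
      then have "h' = r'" using partial_iso_eq[OF \<phi> h r'] by blast
      then show ?thesis using True r r'c' by blast
    qed (use f(3,4)[OF h] r' in blast)
  qed
  then show ?thesis by blast
qed

text \<open>The position of the gate \<open>r\<close> of \<open>c\<close> decides. If
  \<open>r\<close> is in the domain, \<open>c\<close> is an end; if \<open>r = c\<close>, it is on
  an edge. Otherwise \<open>a\<close>, \<open>b\<close>, \<open>c\<close> lie in three directions at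
  \<open>r\<close>, so \<open>r\<close> is a branch point; inserting it first keeps the domain
  closed under centres and turns \<open>c\<close> into an end.\<close>

lemma extend_domain:
  assumes \<phi>: "partial_iso \<phi>" "\<phi> \<noteq> {}" and c: "c \<in> branch"
  shows "\<exists>\<psi>. partial_iso \<psi> \<and> \<phi> \<subseteq> \<psi> \<and> c \<in> Domain \<psi>"
proof (cases "c \<in> Domain \<phi>")
  case False
  note D = partial_isoD[OF \<phi>(1)]
  have cP: "c \<in> P" using c by (simp add: branch_def)
  obtain r a b where r: "r \<in> P" "\<And>f. f \<in> Domain \<phi> \<Longrightarrow> \<not> E r c f" 
      and ab: "a \<in> Domain \<phi>" "b \<in> Domain \<phi>" "\<not> E r a b"
    using gate_exists[OF D(2) _ D(5) cP] \<phi>(2) Domain_empty_iff by metis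
  show ?thesis
  proof (cases "r \<in> Domain \<phi>")
    case True
    then show ?thesis
      using insert_end[OF \<phi>(1) c False True r(2)] by blast
  next
    case rD: False
    show ?thesis
    proof (cases "r = c")
      case True
      then show ?thesis
        using insert_between[OF \<phi>(1) c False ab(1,2)] ab(3) by blast
    next
      case rc: False
      have aP: "a \<in> P - {r}" "b \<in> P - {r}" "c \<in> P - {r}"
        using ab rD rc cP D by blast+
      have ne: "\<not> E r a b" "\<not> E r c a" "\<not> E r c b"
        using ab r by blast+
      have rB: "r \<in> branch"
        using branchI[OF r(1) aP ne(1) _ _] ne E_comm by blast
      obtain r' where \<psi>: "partial_iso (insert (r, r') \<phi>)"
        using insert_between[OF \<phi>(1) rB rD ab] by blast
      have "\<not> E r c f" if "f \<in> Domain (insert (r, r') \<phi>)" for f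
        using that r E_irrefl' by auto
      then obtain c' where "partial_iso (insert (c, c') (insert (r, r') \<phi>))"
        using insert_end[OF \<psi> c, of r] False rc by auto
      then show ?thesis by blast
    qed
  qed
qed (use \<phi> in blast)

lemma extend_range:
  assumes \<phi>: "partial_iso \<phi>" "\<phi> \<noteq> {}" and c: "c \<in> branch"
  shows "\<exists>\<psi>. partial_iso \<psi> \<and> \<phi> \<subseteq> \<psi> \<and> c \<in> Range \<psi>"
proof -
  obtain \<psi> where "partial_iso \<psi>" "\<phi>\<inverse> \<subseteq> \<psi>" "c \<in> Domain \<psi>"
    using extend_domain[OF partial_iso_converse[OF \<phi>(1)] _ c] \<phi>(2) by auto
  then show ?thesis
    by (intro exI[of _ "\<psi>\<inverse>"]) (auto intro: partial_iso_converse)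
qed

theorem back_and_forth:
  assumes "countable branch" and \<phi>: "partial_iso \<phi>" "\<phi> \<noteq> {}"
  obtains \<sigma> where "bij_betw \<sigma> branch branch" 
    "\<And>p a b. p \<in> branch \<Longrightarrow> a \<in> branch \<Longrightarrow> b \<in> branch \<Longrightarrow> E p a b \<longleftrightarrow> E (\<sigma> p) (\<sigma> a) (\<sigma> b)"
    "\<And>a a'. (a, a') \<in> \<phi> \<Longrightarrow> \<sigma> a = a'"
proof -
  have ne: "branch \<noteq> {}" using partial_isoD(3)[OF \<phi>(1)] \<phi>(2) by auto
  define e where "e = from_nat_into branch"
  have e: "range e = branch" "\<And>n. e n \<in> branch"
    unfolding e_def using range_from_nat_into[OF ne assms(1)] from_nat_into[OF ne] by auto
  have "\<exists>\<Phi>. \<forall>n. (partial_iso (\<Phi> n) \<and> \<phi> \<subseteq> \<Phi> n) \<and> 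
               (\<Phi> n \<subseteq> \<Phi> (Suc n) \<and> e n \<in> Domain (\<Phi> (Suc n)) \<and> e n \<in> Range (\<Phi> (Suc n)))"
  proof (rule dependent_nat_choice)
    fix \<psi> n assume \<psi>: "partial_iso \<psi> \<and> \<phi> \<subseteq> \<psi>"
    then obtain \<psi>1 where 1: "partial_iso \<psi>1" "\<psi> \<subseteq> \<psi>1" "e n \<in> Domain \<psi>1"
      using extend_domain[of \<psi> "e n"] e \<phi> by auto
    then obtain \<psi>2 where "partial_iso \<psi>2" "\<psi>1 \<subseteq> \<psi>2" "e n \<in> Range \<psi>2"
      using extend_range[of \<psi>1 "e n"] e by auto
    then show "\<exists>\<psi>'. (partial_iso \<psi>' \<and> \<phi> \<subseteq> \<psi>') \<and> (\<psi> \<subseteq> \<psi>' \<and> e n \<in> Domain \<psi>' \<and> e n \<in> Range \<psi>')"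
      using 1 \<psi> by (intro exI[of _ \<psi>2]) blast
  qed (use \<phi> in blast)
  then obtain \<Phi> where \<Phi>: "\<And>n. partial_iso (\<Phi> n)" "\<And>n. \<phi> \<subseteq> \<Phi> n" "\<And>n. \<Phi> n \<subseteq> \<Phi> (Suc n)" 
      "\<And>n. e n \<in> Domain (\<Phi> (Suc n))" "\<And>n. e n \<in> Range (\<Phi> (Suc n))"
    by blast
  have mono: "\<Phi> m \<subseteq> \<Phi> n" if "m \<le> n" for m n
    using lift_Suc_mono_le[of \<Phi>] \<Phi>(3) that by blast
  define R where "R = (\<Union>n. \<Phi> n)"
  have common: "\<exists>n. (p, p') \<in> \<Phi> n \<and> (a, a') \<in> \<Phi> n \<and> (b, b') \<in> \<Phi> n"
    if pab: "(p, p') \<in> R" "(a, a') \<in> R" "(b, b') \<in> R" for p p' a a' b b'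
  proof -
    obtain i j k where ijk: "(p, p') \<in> \<Phi> i" "(a, a') \<in> \<Phi> j" "(b, b') \<in> \<Phi> k"
      using pab by (auto simp: R_def)
    have "i \<le> i + j + k" "j \<le> i + j + k" "k \<le> i + j + k" by auto
    then show ?thesis
      using ijk mono by blast
  qed
  have RE: "E p a b \<longleftrightarrow> E p' a' b'" if "(p, p') \<in> R" "(a, a') \<in> R" "(b, b') \<in> R" for p p' a a' b b'
    using common[OF that] partial_iso_E[OF \<Phi>(1)] by blast
  have Req: "a = b \<longleftrightarrow> a' = b'" if "(a, a') \<in> R" "(b, b') \<in> R" for a a' b b'
    using common[OF that that(2)] partial_iso_eq[OF \<Phi>(1)] by blast
  have dom: "branch \<subseteq> Domain R" "branch \<subseteq> Range R"
    using \<Phi>(4,5) unfolding R_def e(1)[symmetric] by blast+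
  have sub: "R \<subseteq> branch \<times> branch"
    using partial_isoD(3,4)[OF \<Phi>(1)] by (fastforce simp: R_def)
  define \<sigma> where "\<sigma> a = (SOME b. (a, b) \<in> R)" for a
  have \<sigma>: "(a, \<sigma> a) \<in> R" if "a \<in> branch" for a
    using that dom someI_ex[of "\<lambda>b. (a, b) \<in> R"] unfolding \<sigma>_def by blast
  have \<sigma>': "\<sigma> a = b" if "(a, b) \<in> R" for a b
    using Req[OF that \<sigma>] that sub by blast
  show ?thesis
  proof
    show "bij_betw \<sigma> branch branch"
    proof (rule bij_betw_imageI)
      show "inj_on \<sigma> branch"
        using Req \<sigma> by (meson inj_onI)
      show "\<sigma> ` branch = branch"
      proof
        show "\<sigma> ` branch \<subseteq> branch"
          using \<sigma> sub by blast
        show "branch \<subseteq> \<sigma> ` branch"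
        proof
          fix b assume "b \<in> branch"
          then obtain a where "(a, b) \<in> R" using dom by blast
          then show "b \<in> \<sigma> ` branch" using \<sigma>'[of a b] sub by blast
        qed
      qed
    qed
    show "E p a b \<longleftrightarrow> E (\<sigma> p) (\<sigma> a) (\<sigma> b)" if "p \<in> branch" "a \<in> branch" "b \<in> branch" for p a b
      using RE \<sigma> that by blast
    show "\<sigma> a = a'" if "(a, a') \<in> \<phi>" for a a'
      using \<sigma>' that \<Phi>(2)[of 0] unfolding R_def by blast
  qed
qed

end

section \<open>Dendrites as separation trees\<close>

lemma compact_metrizable_dense_countable:
  assumes "compact_space X" "metrizable_space X"
  obtains D where "countable D" "D \<subseteq> topspace X" "\<And>U. openin X U \<Longrightarrow> U \<noteq> {} \<Longrightarrow> U \<inter> D \<noteq> {}"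
proof -
  obtain M d where M: "Metric_space M d" and X: "X = Metric_space.mtopology M d"
    using assms metrizable_space_def by blast
  interpret Metric_space M d by (rule M)
  have "mtotally_bounded M"
    using assms(1) X by (metis compact_space_def compactin_imp_mtotally_bounded topspace_mtopology)
  then have "\<exists>K. finite K \<and> K \<subseteq> M \<and> M \<subseteq> (\<Union>x\<in>K. mball x (inverse (real (Suc n))))" for n
    unfolding mtotally_bounded_def by simp
  then obtain K where K: "\<And>n. finite (K n)" "\<And>n. K n \<subseteq> M" 
      "\<And>n. M \<subseteq> (\<Union>x\<in>K n. mball x (inverse (real (Suc n))))"
    by metis
  show ?thesis
  proof
    show "countable (\<Union>n. K n)" using K(1) by (simp add: countable_finite)
    show "(\<Union>n. K n) \<subseteq> topspace X" using K(2) X by auto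
    fix U assume "openin X U" "U \<noteq> {}"
    then obtain x r where x: "x \<in> U" "x \<in> M" "0 < r" "mball x r \<subseteq> U"
      using X by (metis all_not_in_conv openin_mtopology subsetD)
    then obtain n where n: "inverse (real (Suc n)) < r"
      using reals_Archimedean by blast
    obtain y where "y \<in> K n" "x \<in> mball y (inverse (real (Suc n)))"
      using K(3) x by blast
    then have "y \<in> mball x r"
      using n commute by auto
    then show "U \<inter> (\<Union>n. K n) \<noteq> {}"
      using x \<open>y \<in> K n\<close> by blast
  qed
qed

text \<open>Kuratowski's embedding; it makes \<open>path_contains_arc\<close>, stated for complete normed spaces, applicable.\<close>

lemma compact_metrizable_embedding:
  assumes "compact_space X" "metrizable_space X"
  obtains f :: "'a \<Rightarrow> 'a discrete \<Rightarrow>\<^sub>C real" where "embedding_map X euclidean f"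
proof -
  obtain M d where M: "Metric_space M d" and X: "X = Metric_space.mtopology M d"
    using assms metrizable_space_def by blast
  interpret Metric_space M d by (rule M)
  \<comment> \<open>Distances are truncated at 1 to be bounded, and the index type is discrete so
    that every bounded function is continuous; the target is thus a sup-norm space of all bounded
    functions. Indices outside \<open>M\<close> carry the value 0.\<close>
  define h where "h x q = (if of_discrete q \<in> M then min 1 (d x (of_discrete q)) else 0)" for x q
  define f :: "'a \<Rightarrow> 'a discrete \<Rightarrow>\<^sub>C real" where "f x = Bcontfun (h x)" for x
  have f: "apply_bcontfun (f x) = h x" for x
    unfolding f_def
    by (rule Bcontfun_inverse)
       (auto intro!: bcontfun_normI[of _ 1] simp: continuous_on_open_invariant Discrete_Topology.open_discrete h_def)
  have "continuous_map X euclidean f"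
  proof -
    have "\<exists>U. openin X U \<and> x \<in> U \<and> (\<forall>y\<in>U. dist (f x) (f y) < \<epsilon>)" if "x \<in> M" "0 < \<epsilon>" for x \<epsilon>
    proof (intro exI conjI ballI)
      show "openin X (mball x (\<epsilon> / 2))" "x \<in> mball x (\<epsilon> / 2)"
        using X that by auto
      fix y assume y: "y \<in> mball x (\<epsilon> / 2)"
      have "dist (f x) (f y) \<le> \<epsilon> / 2"
      proof (rule dist_bound)
        fix q
        have "\<bar>d x p - d y p\<bar> \<le> d x y" if "p \<in> M" for p
          using y that triangle[of x y p] triangle[of y x p] commute[of x y] by auto
        then have "of_discrete q \<in> M \<Longrightarrow> \<bar>min 1 (d x (of_discrete q)) - min 1 (d y (of_discrete q))\<bar> \<le> d x y"
          by (smt (verit))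
        then show "dist (f x q) (f y q) \<le> \<epsilon> / 2"
          using y that(2) by (auto simp: f h_def dist_real_def)
      qed
      then show "dist (f x) (f y) < \<epsilon>" using that by simp
    qed
    then show ?thesis
      using Met_TC.continuous_map_to_metric[of X f] X by simp
  qed
  moreover have "inj_on f (topspace X)"
  proof (rule inj_onI)
    fix x y assume xy: "x \<in> topspace X" "y \<in> topspace X" "f x = f y"
    then have "h x (discrete y) = h y (discrete y)"
      using f by metis
    then show "x = y"
      using xy X by (auto simp: h_def discrete_inverse min_def split: if_splits)
  qed
  ultimately have "embedding_map X euclidean f"
    using assms(1) by (intro continuous_imp_embedding_map) auto
  then show ?thesis by (rule that)
qed

lemma locally_connected_compact_metrizable_arc:
  assumes X: "compact_space X" "metrizable_space X" "locally_connected_space X"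
    and U: "openin X U" "connectedin X U" "a \<in> U" "b \<in> U" and "a \<noteq> b"
  shows "\<exists>A. is_arc_between X A a b \<and> A \<subseteq> U"
proof -
  obtain f :: "'a \<Rightarrow> 'a discrete \<Rightarrow>\<^sub>C real" where "embedding_map X euclidean f"
    using compact_metrizable_embedding[OF X(1,2)] by blast
  define K where "K = f ` topspace X"
  have f: "homeomorphic_map X (top_of_set K) f"
    using \<open>embedding_map X euclidean f\<close> by (simp add: embedding_map_def K_def)
  then obtain g where g: "homeomorphic_maps X (top_of_set K) f g"
    using homeomorphic_map_maps by blast
  have "compact K"
    using f X(1) by (metis compact_space_subtopology homeomorphic_compact_space homeomorphic_map_imp_homeomorphic_space
        compact_space_def compactin_euclidean_iff compactin_subtopology topspace_euclidean_subtopology)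
  have lcK: "locally_connected_space (top_of_set K)"
    using f X(3) homeomorphic_locally_connected_space homeomorphic_map_imp_homeomorphic_space by blast
  have lc: "\<exists>W. openin (top_of_set K) W \<and> connected W \<and> x \<in> W \<and> W \<subseteq> V"
    if "openin (top_of_set K) V" "x \<in> V" for V x
    using lcK[unfolded locally_connected_space] that connectedin_subtopology connectedin_iff_connected by metis
  have sub: "U \<subseteq> topspace X" using U openin_subset by blast
  have "openin (top_of_set K) (f ` U)" "connected (f ` U)"
    using homeomorphic_map_openness[OF f sub] homeomorphic_map_connectedness[OF f sub] U
    by (auto simp: connectedin_subtopology)
  then obtain p where p: "path p" "path_image p \<subseteq> f ` U" "pathstart p = f a" "pathfinish p = f b"
    using locally_connected_compact_path[OF \<open>compact K\<close> lc, of "f ` U" "f a" "f b"] U by blast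
  have gf: "\<And>x. x \<in> topspace X \<Longrightarrow> g (f x) = x" and cg: "continuous_map (top_of_set K) X g"
    using g by (auto simp: homeomorphic_maps_def)
  have fg: "f (g y) = y" "g y \<in> U" if "y \<in> f ` U" for y
    using that gf sub by auto
  have "f a \<noteq> f b"
    using gf \<open>a \<noteq> b\<close> U sub by (metis subsetD)
  then obtain q where q: "arc q" "path_image q \<subseteq> path_image p" "pathstart q = f a" "pathfinish q = f b"
    by (rule path_contains_arc[OF p(1,3,4)])
  have qK: "q \<in> {0..1} \<rightarrow> f ` U"
    using q(2) p(2) by (auto simp: path_image_def)
  then have qU: "q t \<in> f ` U" if "0 \<le> t" "t \<le> 1" for t
    using that by (meson PiE atLeastAtMost_iff)
  have "f ` U \<subseteq> K" using sub by (auto simp: K_def)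
  have "continuous_map (top_of_set {0..1}) (top_of_set K) q"
    using q(1) qK \<open>f ` U \<subseteq> K\<close> by (auto simp: arc_def path_def)
  then have "continuous_map (top_of_set {0..1}) X (g \<circ> q)"
    using cg continuous_map_compose by blast
  moreover have "inj_on (g \<circ> q) {0..1}"
  proof (rule comp_inj_on)
    show "inj_on q {0..1}" using q(1) by (simp add: arc_def)
    show "inj_on g (q ` {0..1})"
      using fg qU by (intro inj_on_inverseI[where g = f]) auto
  qed
  ultimately have "embedding_map (top_of_set {0..1}) X (g \<circ> q)"
    using X(2) metrizable_imp_Hausdorff_space
    by (intro continuous_imp_embedding_map) (auto simp: compact_space_subtopology compactin_euclidean_iff)
  moreover have "(g \<circ> q) 0 = a" "(g \<circ> q) 1 = b"
    using q(3,4) gf U sub by (auto simp: pathstart_def pathfinish_def subset_eq)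
  moreover have "(g \<circ> q) ` {0..1} \<subseteq> U"
    using qU fg(2) by auto
  ultimately show ?thesis
    unfolding is_arc_between_def by blast
qed

section \<open>Separation, arcs and centres in a dendrite\<close>

definition joined :: "'a topology \<Rightarrow> 'a \<Rightarrow> 'a \<Rightarrow> 'a \<Rightarrow> bool" where
  "joined X p a b \<longleftrightarrow> (\<exists>C. connectedin X C \<and> a \<in> C \<and> b \<in> C \<and> p \<notin> C)"

lemma joined_component:
  "Collect (joined X p a) = connected_component_of_set (subtopology X (topspace X - {p})) a"
  unfolding joined_def connected_component_of_def connectedin_subtopology
  using connectedin_subset_topspace by fastforce

text \<open>If \<open>x\<close> did not separate \<open>a\<close> from \<open>b\<close>, both would
  lie in one component of its complement. That component is open and connected, so it contains an
  arc from \<open>a\<close> to \<open>b\<close>, which avoids \<open>x\<close> and yet equals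
  \<open>A\<close> by uniqueness.\<close>

lemma arc_separates:
  assumes "dendrite X" "is_arc_between X A a b" "x \<in> A" "x \<noteq> a" "x \<noteq> b"
  shows "\<not> joined X x a b"
proof
  assume j: "joined X x a b"
  have X: "compact_space X" "metrizable_space X" "locally_connected_space X"
    using assms(1) by (auto simp: dendrite_def)
  have ab: "a \<in> topspace X" "b \<in> topspace X"
    using j connectedin_subset_topspace unfolding joined_def by blast+
  have "a \<noteq> b"
  proof -
    obtain h where "embedding_map (top_of_set {0..1::real}) X h" "h 0 = a" "h 1 = b"
      using assms(2) is_arc_between_def by metis
    then have "inj_on h {0..1}"
      by (metis homeomorphic_imp_injective_map embedding_map_def topspace_euclidean_subtopology)
    then show ?thesis
      using \<open>h 0 = a\<close> \<open>h 1 = b\<close> by (metis atLeastAtMost_iff inj_onD order_refl zero_le_one zero_neq_one)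
  qed
  let ?U = "Collect (joined X x a)"
  have "openin X (topspace X - {x})"
    using metrizable_imp_t1_space[OF X(2)] unfolding t1_space_openin_delete_alt by blast
  then have "openin X ?U"
    using X(3) assms(4) ab unfolding joined_component
    by (metis Diff_iff insert_absorb insert_not_empty locally_connected_space_eq_open_connected_component_of singletonD)
  moreover have "connectedin X ?U"
    unfolding joined_component using connectedin_connected_component_of connectedin_subtopology by metis
  moreover have "a \<in> ?U" "b \<in> ?U"
    using j unfolding joined_def by blast+
  ultimately obtain B where "is_arc_between X B a b" "B \<subseteq> ?U"
    using locally_connected_compact_metrizable_arc[OF X _ _ _ _ \<open>a \<noteq> b\<close>] by metis
  moreover have "B = A"
    using assms(1,2) ab \<open>a \<noteq> b\<close> \<open>is_arc_between X B a b\<close> unfolding dendrite_def by metis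
  ultimately show False
    using assms(3) by (auto simp: joined_def)
qed

lemma joined_dom: "joined X p a b \<Longrightarrow> a \<in> topspace X \<and> b \<in> topspace X"
  using connectedin_subset_topspace unfolding joined_def by blast

locale dendrite_space =
  fixes X :: "'a topology"
  assumes dendrite: "dendrite X"
begin

lemma compact: "compact_space X" and connected: "connected_space X" 
  and locally_connected: "locally_connected_space X" and metrizable: "metrizable_space X"
  and nontrivial: "\<exists>x\<in>topspace X. \<exists>y\<in>topspace X. x \<noteq> y"
  using dendrite by (auto simp: dendrite_def)

lemma Hausdorff: "Hausdorff_space X"
  using metrizable by (rule metrizable_imp_Hausdorff_space)

lemma arc_exists:
  assumes "a \<in> topspace X" "b \<in> topspace X" "a \<noteq> b"
  obtains A where "is_arc_between X A a b"
  using dendrite assms unfolding dendrite_def by blast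

lemma openin_delete: "openin X (topspace X - {p})"
  using metrizable_imp_t1_space[OF metrizable] unfolding t1_space_openin_delete_alt by blast

lemma openin_joined: "openin X (Collect (joined X p a))"
proof (cases "a \<in> topspace X - {p}")
  case True
  then show ?thesis
    using locally_connected[unfolded locally_connected_space_eq_open_connected_component_of] openin_delete[of p]
    unfolding joined_component by blast
next
  case False
  then have "Collect (joined X p a) = {}"
    unfolding joined_component
    by (metis Int_iff connected_component_of_eq_empty topspace_subtopology Diff_iff)
  then show ?thesis by (metis openin_empty)
qed

lemma connectedin_joined: "connectedin X (Collect (joined X p a))"
  unfolding joined_component using connectedin_connected_component_of connectedin_subtopology by metis

lemma joined_sym: "joined X p a b \<Longrightarrow> joined X p b a"
  unfolding joined_def by blast

lemma joined_trans: "joined X p a b \<Longrightarrow> joined X p b c \<Longrightarrow> joined X p a c"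
  unfolding joined_def
  by (metis Int_iff Un_iff connectedin_Un empty_iff)

lemma joined_refl: "a \<in> topspace X \<Longrightarrow> a \<noteq> p \<Longrightarrow> joined X p a a"
  unfolding joined_def by (intro exI[of _ "{a}"]) (auto simp: connectedin_sing)

text \<open>The components of the complement of \<open>p\<close> are all open, so a component has no
  limit points in the others.\<close>

lemma closure_joined: "X closure_of Collect (joined X p a) \<subseteq> insert p (Collect (joined X p a))"
proof
  fix y assume y: "y \<in> X closure_of Collect (joined X p a)"
  show "y \<in> insert p (Collect (joined X p a))"
  proof (cases "y = p")
    case False
    then have "y \<in> Collect (joined X p y)"
      using y joined_refl by (auto simp: in_closure_of)
    then obtain z where "joined X p a z" "joined X p y z"
      using y openin_joined[of p y] unfolding in_closure_of by blast
    then show ?thesis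
      using joined_sym joined_trans by blast
  qed simp
qed

text \<open>The point \<open>p\<close> adheres to each component of its complement, for such a
  component would otherwise be clopen. Adding \<open>p\<close> to the component of \<open>a\<close>
  leaves it connected; if \<open>q\<close> is not in it, it joins \<open>a\<close> to
  \<open>p\<close> away from \<open>q\<close>.\<close>

lemma joined_switch:
  assumes "p \<in> topspace X" "q \<in> topspace X" "a \<in> topspace X" "p \<noteq> q"
  shows "joined X p a q \<or> joined X q a p"
proof (rule ccontr)
  assume n: "\<not> (joined X p a q \<or> joined X q a p)"
  then have "a \<noteq> p" "a \<noteq> q"
    using joined_refl[of p q] joined_refl[of q p] assms by auto
  let ?C = "Collect (joined X p a)"
  have "a \<in> ?C" using joined_refl assms \<open>a \<noteq> p\<close> by blast
  have "p \<in> X closure_of ?C"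
  proof (rule ccontr)
    assume "p \<notin> X closure_of ?C"
    then have "X closure_of ?C \<subseteq> ?C"
      using closure_joined[of p a] by blast
    then have "closedin X ?C"
      using openin_subset[OF openin_joined[of p a]] by (simp add: closure_of_subset_eq[symmetric])
    then have "?C = topspace X"
      using connected[unfolded connected_space_clopen_in] \<open>a \<in> ?C\<close> openin_joined[of p a] by (metis empty_iff)
    then show False
      using assms(1) by (auto simp: joined_def)
  qed
  then have "insert p ?C \<subseteq> X closure_of ?C"
    using closure_of_subset[OF openin_subset[OF openin_joined[of p a]]] by blast
  then have "connectedin X (insert p ?C)"
    by (rule connectedin_intermediate_closure_of[OF connectedin_joined[of p a] subset_insertI])
  moreover have "q \<notin> insert p ?C"
    using n assms(4) by blast
  ultimately have "joined X q a p"
    by (subst joined_def, intro exI[of _ "insert p ?C"] conjI) (use \<open>a \<in> ?C\<close> in simp_all)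
  then show False using n by blast
qed

lemma arc_iff:
  assumes "is_arc_between X A a b"
  shows "p \<in> A \<longleftrightarrow> p \<in> topspace X \<and> \<not> joined X p a b"
proof -
  obtain h where h: "embedding_map (top_of_set {0..1::real}) X h" "h ` {0..1} = A" "h 0 = a" "h 1 = b"
    using assms is_arc_between_def by metis
  then have A: "connectedin X A" "a \<in> A" "b \<in> A"
    using connectedin_continuous_map_image[of "top_of_set {0..1}" X h "{0..1}"]
    by (auto simp: embedding_map_def homeomorphic_imp_continuous_map continuous_map_in_subtopology
         connectedin_subtopology dest!: homeomorphic_imp_continuous_map)
  have "p \<in> A" if "\<not> joined X p a b" "p \<in> topspace X"
    using A that unfolding joined_def by blast
  moreover have "\<not> joined X p a b" if "p \<in> A"
  proof (cases "p = a \<or> p = b")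
    case False
    then show ?thesis
      using arc_separates[OF dendrite assms that] by blast
  qed (auto simp: joined_def)
  ultimately show ?thesis
    using connectedin_subset_topspace[OF A(1)] by blast
qed

lemma arc_connected_closed:
  assumes "is_arc_between X A a b"
  shows "connectedin X A" "closedin X A"
proof -
  obtain h where h: "embedding_map (top_of_set {0..1::real}) X h" "h ` {0..1} = A" "h 0 = a" "h 1 = b"
    using assms is_arc_between_def by metis
  then have c: "continuous_map (top_of_set {0..1}) X h"
    by (metis continuous_map_in_subtopology embedding_map_def homeomorphic_imp_continuous_map)
  show "connectedin X A"
    using connectedin_continuous_map_image[OF c, of "{0..1}"] h(2) by (simp add: connectedin_subtopology)
  have "compactin X A"
    using image_compactin[OF _ c, of "{0..1}"] h(2) by (simp add: compactin_subtopology)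
  then show "closedin X A"
    using Hausdorff compactin_imp_closedin by blast
qed

text \<open>A point separating \<open>a\<close> from \<open>b\<close> separates one of them from
  \<open>c\<close>, so the arc \<open>A\<close> is covered by the closed arcs \<open>B\<close> and
  \<open>C\<close>. As \<open>A\<close> is connected and meets both, it contains a common
  point.\<close>

lemma joined_centre:
  assumes "a \<in> topspace X" "b \<in> topspace X" "c \<in> topspace X"
  shows "\<exists>m\<in>topspace X. \<not> joined X m a b \<and> \<not> joined X m b c \<and> \<not> joined X m a c"
proof (cases "a = b \<or> b = c \<or> a = c")
  case True
  then show ?thesis
    using assms unfolding joined_def by blast
next
  case False
  then obtain A B C where ABC: "is_arc_between X A a b" "is_arc_between X B a c" "is_arc_between X C b c"
    using arc_exists assms by metis
  have "A \<subseteq> B \<union> C"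
    using ABC[THEN arc_iff] joined_sym joined_trans by blast
  moreover have "a \<in> A" "a \<in> B" "b \<in> A" "b \<in> C"
    using ABC[THEN arc_iff] assms by (auto simp: joined_def)
  ultimately have "A \<inter> B \<inter> C \<noteq> {}"
    using arc_connected_closed(1)[OF ABC(1)] arc_connected_closed(2)[OF ABC(2)] arc_connected_closed(2)[OF ABC(3)]
    unfolding connectedin_closedin by blast
  then show ?thesis
    using ABC[THEN arc_iff] by blast
qed

sublocale separation_tree "topspace X" "joined X"
proof
  show "joined X p a b \<Longrightarrow> a \<in> topspace X \<and> b \<in> topspace X" for p a b
    by (rule joined_dom)
  show "\<not> joined X p p a" for p a
    by (simp add: joined_def)
qed (use joined_refl joined_sym joined_trans joined_switch joined_centre in blast)+

lemma point_order_eq: "point_order X p = ord p"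
proof -
  have "connected_components_of (subtopology X (topspace X - {p})) = classes p"
    unfolding connected_components_of_def classes_def joined_component by (simp add: Int_absorb1)
  then show ?thesis
    by (simp add: point_order_def ord_def Let_def)
qed

lemma branch_point_eq: "branch_point X p \<longleftrightarrow> p \<in> branch"
  by (simp add: branch_point_def branch_def point_order_eq)

text \<open>Three components at a branch point are open and contain points of a countable dense set;
  the branch point is the unique centre of these.\<close>

lemma countable_branch: "countable branch"
proof -
  obtain D where D: "countable D" "D \<subseteq> topspace X" "\<And>U. openin X U \<Longrightarrow> U \<noteq> {} \<Longrightarrow> U \<inter> D \<noteq> {}"
    using compact_metrizable_dense_countable[OF compact metrizable] by blast
  have D': "\<exists>d\<in>D. joined X p a d" if "a \<in> topspace X - {p}" for p a
    using D(3)[OF openin_joined[of p a]] joined_refl[of a p] that by blast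
  have "branch \<subseteq> (\<Union>(a, b, c)\<in>D \<times> D \<times> D. {m \<in> topspace X. centre m a b c})"
  proof
    fix p assume p: "p \<in> branch"
    then obtain a b c where abc: "a \<in> topspace X - {p}" "b \<in> topspace X - {p}" "c \<in> topspace X - {p}"
       and n: "\<not> joined X p a b" "\<not> joined X p b c" "\<not> joined X p a c"
      using three_classes[of p] unfolding branch_def by blast
    then obtain a' b' c' where d: "a' \<in> D" "b' \<in> D" "c' \<in> D" "joined X p a a'" "joined X p b b'" "joined X p c c'"
      using D' by meson
    then have "centre p a' b' c'"
      using n joined_sym joined_trans unfolding centre_def by meson
    then show "p \<in> (\<Union>(a, b, c)\<in>D \<times> D \<times> D. {m \<in> topspace X. centre m a b c})"
      using d p by (auto simp: branch_def)
  qed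
  moreover have "countable {m \<in> topspace X. centre m a b c}" if "a \<in> D" "b \<in> D" "c \<in> D" for a b c
  proof (cases "{m \<in> topspace X. centre m a b c} = {}")
    case False
    then obtain m where "m \<in> topspace X" "centre m a b c" by blast
    then have "{m \<in> topspace X. centre m a b c} \<subseteq> {m}"
      using centre_unique[of a b c _ m] that D(2) by blast
    then show ?thesis
      by (meson countable_finite finite.intros finite_subset)
  qed (metis countable_empty)
  then have "countable (\<Union>(a, b, c)\<in>D \<times> D \<times> D. {m \<in> topspace X. centre m a b c})"
    using D(1) by (intro countable_UN countable_SIGMA) auto
  ultimately show ?thesis
    by (rule countable_subset)
qed

end

section \<open>Homeomorphisms of \<open>D\<^sub>S\<close>\<close>

locale D_S_space =
  fixes S :: "enat set" and X :: "'a topology"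
  assumes S_nonempty: "S \<noteq> {}" and S_sub: "S \<subseteq> {n. n \<ge> 3}" and D_S: "is_D_S S X"
begin

sublocale dendrite_space X
  using D_S by unfold_locales (simp add: is_D_S_def)

sublocale coloured_tree "topspace X" "joined X" S
proof
  show "3 \<le> n" if "n \<in> S" for n
    using that S_sub by blast
  show "ord p \<in> S" if "p \<in> branch" for p
    using D_S that unfolding is_D_S_def branch_point_eq point_order_eq by blast
  fix a b n assume ab: "a \<in> topspace X" "b \<in> topspace X" "a \<noteq> b" "n \<in> S"
  then obtain A where A: "is_arc_between X A a b"
    using arc_exists by blast
  then obtain x where x: "x \<in> A - {a, b}" "point_order X x = n"
    using D_S ab unfolding is_D_S_def by blast
  then show "\<exists>p\<in>topspace X. \<not> joined X p a b \<and> p \<noteq> a \<and> p \<noteq> b \<and> ord p = n"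
    using arc_iff[OF A, of x] point_order_eq by auto
qed

section \<open>Density of branch points and the subbase of components\<close>

lemma branch_between:
  assumes "a \<in> topspace X" "b \<in> topspace X" "a \<noteq> b"
  obtains p where "p \<in> branch" "\<not> joined X p a b" "p \<noteq> a" "p \<noteq> b"
proof -
  obtain n where "n \<in> S" using S_nonempty by blast
  then obtain p where "p \<in> topspace X" "\<not> joined X p a b" "p \<noteq> a" "p \<noteq> b" "ord p = n"
    using S_dense[OF assms] by blast
  then show ?thesis
    using that S_ge \<open>n \<in> S\<close> unfolding branch_def by blast
qed

lemma branch_in_space: "p \<in> branch \<Longrightarrow> p \<in> topspace X"
  by (simp add: branch_def)

lemma branch_in_class:
  assumes "y \<in> topspace X" "p \<in> topspace X" "y \<noteq> p"
  obtains a where "a \<in> branch" "joined X p a y"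
proof -
  obtain a where "a \<in> branch" "\<not> joined X a p y" "a \<noteq> p" "a \<noteq> y"
    using branch_between[OF assms(2,1)] assms(3) by blast
  then show ?thesis
    using that joined_switch[of p a y] joined_sym assms branch_in_space by blast
qed

text \<open>A connected neighbourhood has a second point, since no point is isolated, and it
  contains every point separating two of its members.\<close>

lemma branch_dense:
  assumes "openin X V" "y \<in> V"
  obtains p where "p \<in> branch" "p \<in> V"
proof -
  obtain W where W: "openin X W" "connectedin X W" "y \<in> W" "W \<subseteq> V"
    using locally_connected[unfolded locally_connected_space] assms by meson
  have "y \<in> topspace X" using W openin_subset by blast
  have "W \<noteq> {y}"
  proof
    assume "W = {y}"
    moreover have "closedin X {y}"
      using Hausdorff \<open>y \<in> topspace X\<close> by (simp add: closedin_Hausdorff_sing_eq)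
    ultimately have "topspace X = {y}"
      using connected[unfolded connected_space_clopen_in] W(1) by (metis insert_not_empty)
    then show False
      using nontrivial by auto
  qed
  then obtain z where z: "z \<in> W" "z \<noteq> y" using W(3) by blast
  then obtain p where p: "p \<in> branch" "\<not> joined X p y z"
    using branch_between[of y z] openin_subset[OF W(1)] \<open>y \<in> topspace X\<close> by blast
  then have "p \<in> W"
    using W(2,3) z unfolding joined_def by blast
  then show ?thesis
    using that p W by blast
qed

text \<open>Each point outside \<open>V\<close> is cut off from \<open>y\<close> by a branch point,
  and its component is open. Finitely many of these components cover the complement of
  \<open>V\<close>, and the components of \<open>y\<close> at the same cut points avoid
  them.\<close>

lemma classes_subbase:
  assumes "openin X V" "y \<in> V"
  obtains Q where "finite Q" "Q \<subseteq> branch \<times> branch" "\<And>p a. (p, a) \<in> Q \<Longrightarrow> joined X p a y"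
    "{z \<in> topspace X. \<forall>(p, a)\<in>Q. joined X p a z} \<subseteq> V"
proof -
  let ?K = "topspace X - V"
  have y: "y \<in> topspace X" using assms openin_subset by blast
  \<comment> \<open>The component of \<open>y\<close> is named by a branch point \<open>a\<close> in
    it, so that a map defined on branch points alone can transport it.\<close>
  have "\<exists>p a. p \<in> branch \<and> a \<in> branch \<and> joined X p a y \<and> \<not> joined X p w y \<and> w \<noteq> p" if "w \<in> ?K" for w
  proof -
    have w: "w \<in> topspace X" "w \<noteq> y" using that assms by auto
    obtain p where p: "p \<in> branch" "\<not> joined X p w y" "p \<noteq> w" "p \<noteq> y"
      using branch_between[OF w(1) y w(2)] by blast
    then show ?thesis
      using branch_in_class[OF y, of p] branch_in_space by metis
  qed
  then obtain p a where pa: "\<And>w. w \<in> ?K \<Longrightarrow> p w \<in> branch" "\<And>w. w \<in> ?K \<Longrightarrow> a w \<in> branch" 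
      "\<And>w. w \<in> ?K \<Longrightarrow> joined X (p w) (a w) y" "\<And>w. w \<in> ?K \<Longrightarrow> \<not> joined X (p w) w y" "\<And>w. w \<in> ?K \<Longrightarrow> w \<noteq> p w"
    by metis
  define O' where "O' w = Collect (joined X (p w) w)" for w
  have "compactin X ?K"
    using assms(1) compact closedin_compact_space by blast
  moreover have "\<And>U. U \<in> O' ` ?K \<Longrightarrow> openin X U"
    using openin_joined by (auto simp: O'_def)
  moreover have "?K \<subseteq> \<Union>(O' ` ?K)"
    using pa(5) joined_refl by (fastforce simp: O'_def)
  ultimately obtain \<F> where "finite \<F>" "\<F> \<subseteq> O' ` ?K" "?K \<subseteq> \<Union>\<F>"
    unfolding compactin_def by meson
  then obtain F where F: "finite F" "F \<subseteq> ?K" "?K \<subseteq> \<Union>(O' ` F)"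
    by (metis finite_subset_image)
  show ?thesis
  proof
    show "finite ((\<lambda>w. (p w, a w)) ` F)" "(\<lambda>w. (p w, a w)) ` F \<subseteq> branch \<times> branch"
      using F pa by auto
    show "joined X q b y" if "(q, b) \<in> (\<lambda>w. (p w, a w)) ` F" for q b
      using that F(2) pa by auto
    show "{z \<in> topspace X. \<forall>(p, a)\<in>(\<lambda>w. (p w, a w)) ` F. joined X p a z} \<subseteq> V"
    proof (rule ccontr)
      assume "\<not> ?thesis"
      then obtain z where z: "z \<in> ?K" "\<And>w. w \<in> F \<Longrightarrow> joined X (p w) (a w) z" by auto
      then obtain w where w: "w \<in> F" "joined X (p w) w z"
        using F(3) by (auto simp: O'_def)
      have "joined X (p w) w y"
        using joined_trans[OF w(2) joined_trans[OF joined_sym[OF z(2)[OF w(1)]]]] pa(3) F(2) w(1) by blast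
      then show False
        using pa(4) F(2) w(1) by blast
    qed
  qed
qed

lemma classes_separate:
  assumes "y \<in> topspace X" "z \<in> topspace X" 
    and eq: "\<And>p a. p \<in> branch \<Longrightarrow> a \<in> branch \<Longrightarrow> joined X p a y \<longleftrightarrow> joined X p a z"
  shows "y = z"
proof (rule ccontr)
  assume "y \<noteq> z"
  then obtain p where p: "p \<in> branch" "\<not> joined X p y z" "p \<noteq> y"
    using branch_between assms(1,2) by metis
  then obtain a where "a \<in> branch" "joined X p a y"
    using branch_in_class[OF assms(1), of p] branch_in_space by metis
  then show False
    using eq p joined_sym joined_trans by blast
qed

section \<open>From automorphisms of the branch points to homeomorphisms\<close>

text \<open>A point that is not a branch point is determined by the components containing it.
  Finitely many of them share a branch point \<open>q\<close>, and \<open>\<sigma> q\<close> lies in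
  their images; compactness then gives a point common to the closures of all the images.\<close>

lemma branch_automorphism_point:
  assumes \<sigma>: "bij_betw \<sigma> branch branch" 
    and E: "\<And>p a b. p \<in> branch \<Longrightarrow> a \<in> branch \<Longrightarrow> b \<in> branch \<Longrightarrow> joined X p a b \<longleftrightarrow> joined X (\<sigma> p) (\<sigma> a) (\<sigma> b)"
    and y: "y \<in> topspace X"
  shows "\<exists>z\<in>topspace X. \<forall>p\<in>branch. \<forall>a\<in>branch. joined X p a y \<longleftrightarrow> joined X (\<sigma> p) (\<sigma> a) z"
proof (cases "y \<in> branch")
  case True
  then show ?thesis
    using E \<sigma> branch_in_space bij_betwE[OF \<sigma>] by (intro bexI[of _ "\<sigma> y"]) simp_all
next
  case False
  have \<sigma>B: "\<sigma> p \<in> branch" if "p \<in> branch" for p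
    using \<sigma> that by (meson bij_betwE)
  define I where "I = {(p, a). p \<in> branch \<and> a \<in> branch \<and> joined X p a y}"
  \<comment> \<open>Closures are taken for the sake of compactness. Each adds at most the cut point
    \<open>\<sigma> p\<close>, which is ruled out below.\<close>
  define K where "K = (\<lambda>(p, a). X closure_of Collect (joined X (\<sigma> p) (\<sigma> a)))"
  have "\<Inter>(K ` I) \<noteq> {}"
  proof -
    have "\<Inter>\<F> \<noteq> {}" if \<F>: "finite \<F>" "\<F> \<subseteq> K ` I" for \<F>
    proof -
      obtain J where J: "finite J" "J \<subseteq> I" "\<F> = K ` J"
        using finite_subset_image[OF \<F>] by blast
      define V where "V = topspace X \<inter> (\<Inter>(p, a)\<in>J. Collect (joined X p a))"
      have "openin X V"
        unfolding V_def using J(1) openin_joined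
        by (cases "J = {}") (auto intro!: openin_Int openin_Inter)
      moreover have "y \<in> V"
        using y J(2) by (auto simp: V_def I_def)
      ultimately obtain q where q: "q \<in> branch" "q \<in> V"
        using branch_dense by blast
      have "\<sigma> q \<in> K j" if "j \<in> J" for j
      proof -
        obtain p a where j: "j = (p, a)" by fastforce
        then have "joined X p a q" "p \<in> branch" "a \<in> branch"
          using q(2) that J(2) by (auto simp: V_def I_def)
        then have "\<sigma> q \<in> Collect (joined X (\<sigma> p) (\<sigma> a))"
          using E q(1) by blast
        then show ?thesis
          using closure_of_subset[OF openin_subset[OF openin_joined]] j unfolding K_def by blast
      qed
      then show ?thesis
        using J(3) by blast
    qed
    moreover have "closedin X C" if "C \<in> K ` I" for C
      using that by (auto simp: K_def)
    ultimately show ?thesis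
      using compact[unfolded compact_space_fip, rule_format, of "K ` I"] by simp
  qed
  then obtain z where z: "\<And>p a. p \<in> branch \<Longrightarrow> a \<in> branch \<Longrightarrow> joined X p a y \<Longrightarrow> 
                                z \<in> X closure_of Collect (joined X (\<sigma> p) (\<sigma> a))"
    by (auto simp: I_def K_def)
  then have z': "z = \<sigma> p \<or> joined X (\<sigma> p) (\<sigma> a) z" if "p \<in> branch" "a \<in> branch" "joined X p a y" for p a
    using closure_joined that by blast
  have "z \<in> topspace X"
  proof -
    obtain p where "p \<in> branch" using branch_dense[OF openin_topspace y] by blast
    then obtain a where "a \<in> branch" "joined X p a y"
      using branch_in_class[OF y, of p] branch_in_space False by metis
    then show ?thesis
      using z \<open>p \<in> branch\<close> in_closure_of by metis
  qed
  moreover have "joined X p a y \<longleftrightarrow> joined X (\<sigma> p) (\<sigma> a) z" if p: "p \<in> branch" and a: "a \<in> branch" for p a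
  proof
    assume j: "joined X p a y"
    \<comment> \<open>A branch point \<open>b\<close> strictly between \<open>p\<close> and
      \<open>y\<close> keeps them apart: the component of \<open>y\<close> at \<open>b\<close>
      misses \<open>p\<close>, so its image misses \<open>\<sigma> p\<close>, although
      \<open>z\<close> is in it.\<close>
    have "z \<noteq> \<sigma> p"
    proof
      assume zp: "z = \<sigma> p"
      obtain b where b: "b \<in> branch" "\<not> joined X b p y" "b \<noteq> p" "b \<noteq> y"
        using branch_between[of p y] p y False branch_in_space by metis
      then obtain c where c: "c \<in> branch" "joined X b c y"
        using branch_in_class[OF y, of b] branch_in_space by metis
      have "\<sigma> p \<noteq> \<sigma> b"
        using inj_onD[OF bij_betw_imp_inj_on[OF \<sigma>] _ p b(1)] b(3) by blast
      then have "joined X (\<sigma> b) (\<sigma> c) (\<sigma> p)"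
        using z'[OF b(1) c] zp by simp
      then have "joined X b c p"
        using E b c p by blast
      then show False
        using b(2) c joined_sym joined_trans by blast
    qed
    then show "joined X (\<sigma> p) (\<sigma> a) z"
      using z' p a j by blast
  next
    assume j: "joined X (\<sigma> p) (\<sigma> a) z"
    obtain c where c: "c \<in> branch" "joined X p c y"
      using branch_in_class[OF y, of p] p branch_in_space False by metis
    have "z \<noteq> \<sigma> p"
      using j by (auto simp: joined_def)
    then have "joined X (\<sigma> p) (\<sigma> c) z"
      using z'[OF p c] by blast
    then have "joined X p a c"
      using E p a c j joined_sym joined_trans by blast
    then show "joined X p a y"
      using c joined_trans by blast
  qed
  ultimately show ?thesis by blast
qed

text \<open>The image of a point is forced by its components. Preimages of subbasic sets are again
  components, which gives continuity; the inverse of \<open>\<sigma>\<close> gives surjectivity, and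
  compactness the rest.\<close>

lemma branch_automorphism_extends:
  assumes \<sigma>: "bij_betw \<sigma> branch branch" 
    and E: "\<And>p a b. p \<in> branch \<Longrightarrow> a \<in> branch \<Longrightarrow> b \<in> branch \<Longrightarrow> joined X p a b \<longleftrightarrow> joined X (\<sigma> p) (\<sigma> a) (\<sigma> b)"
  obtains g where "homeomorphic_map X X g" "\<And>p. p \<in> branch \<Longrightarrow> g p = \<sigma> p"
    "\<And>p a y. p \<in> branch \<Longrightarrow> a \<in> branch \<Longrightarrow> y \<in> topspace X \<Longrightarrow> joined X p a y \<longleftrightarrow> joined X (\<sigma> p) (\<sigma> a) (g y)"
proof -
  obtain g where g: "\<And>y. y \<in> topspace X \<Longrightarrow> g y \<in> topspace X"
    "\<And>p a y. p \<in> branch \<Longrightarrow> a \<in> branch \<Longrightarrow> y \<in> topspace X \<Longrightarrow> joined X p a y \<longleftrightarrow> joined X (\<sigma> p) (\<sigma> a) (g y)"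
    using branch_automorphism_point[OF \<sigma> E] by metis
  have surj: "\<exists>p\<in>branch. q = \<sigma> p" if "q \<in> branch" for q
    using \<sigma> that by (metis bij_betw_imp_surj_on imageE)
  have uniq: "g y = z" if "y \<in> topspace X" "z \<in> topspace X" 
      "\<And>p a. p \<in> branch \<Longrightarrow> a \<in> branch \<Longrightarrow> joined X p a y \<longleftrightarrow> joined X (\<sigma> p) (\<sigma> a) z" for y z
  proof (rule classes_separate[OF g(1)[OF that(1)] that(2)])
    fix q b assume "q \<in> branch" "b \<in> branch"
    then show "joined X q b (g y) \<longleftrightarrow> joined X q b z"
      using surj g(2) that by metis
  qed
  have "continuous_map X X g"
    unfolding continuous_map_def
  proof (intro conjI allI impI)
    show "g \<in> topspace X \<rightarrow> topspace X" using g by blast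
    fix V assume V: "openin X V"
    show "openin X {y \<in> topspace X. g y \<in> V}"
    proof (subst openin_subopen, intro ballI)
      fix y assume "y \<in> {y \<in> topspace X. g y \<in> V}"
      then have y: "y \<in> topspace X" "g y \<in> V" by auto
      obtain Q where Q: "finite Q" "Q \<subseteq> branch \<times> branch" "\<And>p a. (p, a) \<in> Q \<Longrightarrow> joined X p a (g y)"
          "{z \<in> topspace X. \<forall>(p, a)\<in>Q. joined X p a z} \<subseteq> V"
        using classes_subbase[OF V y(2)] by blast
      have "\<forall>q\<in>Q. \<exists>p a. p \<in> branch \<and> a \<in> branch \<and> q = (\<sigma> p, \<sigma> a)"
      proof
        fix q assume "q \<in> Q"
        then have "fst q \<in> branch" "snd q \<in> branch" using Q(2) by auto
        then show "\<exists>p a. p \<in> branch \<and> a \<in> branch \<and> q = (\<sigma> p, \<sigma> a)"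
          using surj by (metis prod.collapse)
      qed
      then obtain p a where pa: "\<And>q. q \<in> Q \<Longrightarrow> p q \<in> branch" "\<And>q. q \<in> Q \<Longrightarrow> a q \<in> branch" 
          "\<And>q. q \<in> Q \<Longrightarrow> q = (\<sigma> (p q), \<sigma> (a q))"
        by metis
      define W where "W = topspace X \<inter> (\<Inter>q\<in>Q. Collect (joined X (p q) (a q)))"
      have "openin X W"
        unfolding W_def using Q(1) openin_joined
        by (cases "Q = {}") (auto intro!: openin_Int openin_Inter)
      moreover have "joined X (p q) (a q) y" if "q \<in> Q" for q
        using g(2)[OF pa(1,2)[OF that] y(1)] Q(3)[of "fst q" "snd q"] pa(3)[OF that] that
        by (metis prod.collapse prod.inject)
      then have "y \<in> W"
        using y(1) by (auto simp: W_def)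
      moreover have "g w \<in> V" if "w \<in> W" for w
      proof -
        have w: "w \<in> topspace X" "\<And>q. q \<in> Q \<Longrightarrow> joined X (p q) (a q) w"
          using that by (auto simp: W_def)
        have "joined X r b (g w)" if "(r, b) \<in> Q" for r b
          using g(2)[OF pa(1,2)[OF that] w(1)] w(2)[OF that] pa(3)[OF that] by simp
        then show ?thesis
          using Q(4) g(1)[OF w(1)] by blast
      qed
      ultimately show "\<exists>T. openin X T \<and> y \<in> T \<and> T \<subseteq> {y \<in> topspace X. g y \<in> V}"
        using openin_subset by (intro exI[of _ W]) blast
    qed
  qed
  moreover have "g ` topspace X = topspace X"
  proof
    show "topspace X \<subseteq> g ` topspace X"
    proof
      fix z assume z: "z \<in> topspace X"
      define \<tau> where "\<tau> = inv_into branch \<sigma>"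
      have \<tau>: "bij_betw \<tau> branch branch" "\<And>p. p \<in> branch \<Longrightarrow> \<tau> (\<sigma> p) = p" "\<And>p. p \<in> branch \<Longrightarrow> \<sigma> (\<tau> p) = p"
          "\<And>p. p \<in> branch \<Longrightarrow> \<sigma> p \<in> branch"
        using \<sigma> unfolding \<tau>_def
        by (auto simp: bij_betw_inv_into bij_betw_inv_into_left bij_betw_inv_into_right bij_betwE)
      then have "joined X p a b \<longleftrightarrow> joined X (\<tau> p) (\<tau> a) (\<tau> b)"
        if "p \<in> branch" "a \<in> branch" "b \<in> branch" for p a b
        using E[of "\<tau> p" "\<tau> a" "\<tau> b"] bij_betwE[OF \<tau>(1)] \<tau>(3) that by simp
      then obtain y where y: "y \<in> topspace X" 
          "\<forall>p\<in>branch. \<forall>a\<in>branch. joined X p a z \<longleftrightarrow> joined X (\<tau> p) (\<tau> a) y"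
        using branch_automorphism_point[OF \<tau>(1) _ z] by metis
      have "g y = z"
        using uniq[OF y(1) z] y(2) \<tau> by metis
      then show "z \<in> g ` topspace X" using y by blast
    qed
  qed (use g in blast)
  moreover have "inj_on g (topspace X)"
  proof (rule inj_onI)
    fix y z assume "y \<in> topspace X" "z \<in> topspace X" "g y = g z"
    then show "y = z"
      using classes_separate g(2) by metis
  qed
  ultimately have "homeomorphic_map X X g"
    using continuous_imp_homeomorphic_map compact Hausdorff by blast
  moreover have "g p = \<sigma> p" if "p \<in> branch" for p
    using uniq[of p "\<sigma> p"] E that \<sigma> branch_in_space by (meson bij_betwE)
  ultimately show ?thesis
    using that g(2) by blast
qed

text \<open>Back and forth from \<open>x \<mapsto> x\<close>, \<open>c1 \<mapsto> c2\<close> gives a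
  homeomorphism that preserves the component of \<open>c\<close> at \<open>x\<close>. Off this
  component it may be replaced by the identity.\<close>

lemma homeo_moving:
  assumes x: "x \<in> branch" and c: "c1 \<in> branch" "c2 \<in> branch" "ord c1 = ord c2" "joined X x c c1" "joined X x c c2"
  obtains g where "g \<in> Homeo X" "g c1 = c2" "\<And>y. \<not> joined X x c y \<Longrightarrow> g y = y"
proof -
  have P: "x \<in> topspace X" "c1 \<in> topspace X" "c2 \<in> topspace X" using assms branch_in_space by auto
  have ne: "c1 \<noteq> x" "c2 \<noteq> x" using c by (auto simp: joined_def)
  \<comment> \<open>Among three members of a two-point set one is repeated, and it is the
    centre.\<close>
  have "centre_closed {x, c1}"
  proof -
    have "centre m m m n" "centre m m n m" "centre m n m m" for m n
      by (simp_all add: centre_def joined_def)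
    then show ?thesis
      unfolding centre_closed_def by (metis insertE singletonD insertI1 insertI2)
  qed
  have jc: "joined X x c1 c1" "joined X x c2 c2" "joined X c1 x x" "joined X c2 x x"
    using joined_refl P ne by auto
  have nj: "\<not> joined X p p y" "\<not> joined X p y p" for p y
    by (auto simp: joined_def)
  have pi: "partial_iso {(x, x), (c1, c2)}"
  proof (rule partial_isoI)
    show "finite {(x, x), (c1, c2)}" "{(x, x), (c1, c2)} \<subseteq> branch \<times> branch"
      using assms by auto
    show "centre_closed (Domain {(x, x), (c1, c2)})"
      using \<open>centre_closed {x, c1}\<close> by (simp add: insert_commute)
    show "ord p = ord p'" if "(p, p') \<in> {(x, x), (c1, c2)}" for p p'
      using that c by auto
    show "joined X p a b \<longleftrightarrow> joined X p' a' b'" if "(p, p') \<in> {(x, x), (c1, c2)}" 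
        "(a, a') \<in> {(x, x), (c1, c2)}" "(b, b') \<in> {(x, x), (c1, c2)}" for p p' a a' b b'
      using that jc nj by auto
  qed
  have "{(x, x), (c1, c2)} \<noteq> {}" by simp
  then obtain \<sigma> where \<sigma>: "bij_betw \<sigma> branch branch" 
      "\<And>p a b. p \<in> branch \<Longrightarrow> a \<in> branch \<Longrightarrow> b \<in> branch \<Longrightarrow> joined X p a b \<longleftrightarrow> joined X (\<sigma> p) (\<sigma> a) (\<sigma> b)"
      "\<And>a a'. (a, a') \<in> {(x, x), (c1, c2)} \<Longrightarrow> \<sigma> a = a'"
    using back_and_forth[OF countable_branch pi] by blast
  obtain g where g: "homeomorphic_map X X g" "\<And>p. p \<in> branch \<Longrightarrow> g p = \<sigma> p"
      "\<And>p a y. p \<in> branch \<Longrightarrow> a \<in> branch \<Longrightarrow> y \<in> topspace X \<Longrightarrow> joined X p a y \<longleftrightarrow> joined X (\<sigma> p) (\<sigma> a) (g y)"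
    using branch_automorphism_extends[OF \<sigma>(1,2)] by blast
  let ?C = "Collect (joined X x c)"
  have \<sigma>x: "\<sigma> x = x" "\<sigma> c1 = c2" using \<sigma>(3) by auto
  have cls: "joined X x c1 y \<longleftrightarrow> joined X x c y" "joined X x c2 y \<longleftrightarrow> joined X x c y" for y
    using c(4,5) joined_sym joined_trans by blast+
  have gC: "joined X x c y \<longleftrightarrow> joined X x c (g y)" if "y \<in> topspace X" for y
    using g(3)[OF x c(1) that] \<sigma>x cls by auto
  have gX: "g ` topspace X = topspace X" "inj_on g (topspace X)" "continuous_map X X g" "g x = x" "g c1 = c2"
    using g \<sigma>x x c(1)
    by (auto simp: homeomorphic_imp_surjective_map homeomorphic_imp_injective_map homeomorphic_imp_continuous_map)
  \<comment> \<open>The two pieces agree on the frontier of the component, which is at most the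
    fixed point \<open>x\<close>.\<close>
  define h where "h y = (if joined X x c y then g y else y)" for y
  have "continuous_map X X h"
    unfolding h_def
  proof (rule continuous_map_cases)
    show "continuous_map (subtopology X (X closure_of ?C)) X g"
      using gX(3) continuous_map_from_subtopology by blast
    show "continuous_map (subtopology X (X closure_of {y. \<not> joined X x c y})) X (\<lambda>y. y)"
      using continuous_map_from_subtopology[OF continuous_map_id] by (simp add: id_def)
    fix y assume "y \<in> X frontier_of ?C"
    then have "y = x"
      using closure_joined[of x c] openin_joined[of x c] by (auto simp: frontier_of_def interior_of_openin)
    then show "g y = y" using gX(4) by simp
  qed
  moreover have "h ` topspace X = topspace X"
  proof
    show "h ` topspace X \<subseteq> topspace X"
      using gX(1) by (auto simp: h_def)
    show "topspace X \<subseteq> h ` topspace X"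
    proof
      fix z assume z: "z \<in> topspace X"
      then obtain y where y: "y \<in> topspace X" "g y = z"
        using gX(1) by (metis imageE)
      show "z \<in> h ` topspace X"
      proof (cases "joined X x c z")
        case True
        then show ?thesis using y gC[OF y(1)] by (intro image_eqI[of _ _ y]) (auto simp: h_def)
      next
        case False
        then show ?thesis using z by (intro image_eqI[of _ _ z]) (auto simp: h_def)
      qed
    qed
  qed
  moreover have "inj_on h (topspace X)"
  proof (rule inj_onI)
    fix y z assume "y \<in> topspace X" "z \<in> topspace X" "h y = h z"
    then show "y = z"
      using gC[of y] gC[of z] gX(2) unfolding h_def by (metis inj_onD)
  qed
  ultimately have "homeomorphic_map X X h"
    using continuous_imp_homeomorphic_map compact Hausdorff by blast
  moreover have "h y = y" if "y \<notin> topspace X" for y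
    using that joined_dom[of X x c y] by (auto simp: h_def)
  ultimately have "h \<in> Homeo X" by (simp add: Homeo_def)
  moreover have "h c1 = c2" using gX(5) c(4) by (simp add: h_def)
  ultimately show ?thesis
    using that by (simp add: h_def)
qed

end

section \<open>Group topologies on the homeomorphism group\<close>

lemma HomeoD:
  assumes "f \<in> Homeo X"
  shows "homeomorphic_map X X f" "x \<notin> topspace X \<Longrightarrow> f x = x" "f ` topspace X = topspace X" "inj_on f (topspace X)"
  using assms by (auto simp: Homeo_def homeomorphic_imp_surjective_map homeomorphic_imp_injective_map)

lemma Homeo_in_space: "f \<in> Homeo X \<Longrightarrow> f x \<in> topspace X \<longleftrightarrow> x \<in> topspace X"
  using HomeoD(2,3) by (metis imageI)

lemma Homeo_inj: "f \<in> Homeo X \<Longrightarrow> inj f"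
  using HomeoD(2,4) Homeo_in_space by (metis inj_onD injI)

lemma Homeo_id: "id \<in> Homeo X"
  by (simp add: Homeo_def)

lemma Homeo_inv:
  assumes f: "f \<in> Homeo X"
  shows "homeo_inv X f \<in> Homeo X" "f (homeo_inv X f x) = x" "homeo_inv X f (f x) = x"
proof -
  obtain g where g: "homeomorphic_maps X X f g"
    using HomeoD(1)[OF f] homeomorphic_map_maps by blast
  have eq: "homeo_inv X f y = g y" if "y \<in> topspace X" for y
  proof -
    have "g y \<in> topspace X" "f (g y) = y"
      using g that by (auto simp: homeomorphic_maps_def continuous_map_def)
    then have "inv_into (topspace X) f y = g y"
      using HomeoD(4)[OF f] by (metis inv_into_f_f)
    then show ?thesis
      using that by (simp add: homeo_inv_def)
  qed
  have "homeomorphic_map X X g"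
    using g homeomorphic_map_maps homeomorphic_maps_sym by blast
  then have "homeomorphic_map X X (homeo_inv X f)"
    using eq homeomorphic_map_eq by metis
  then show "homeo_inv X f \<in> Homeo X"
    by (simp add: Homeo_def homeo_inv_def)
  show fi: "f (homeo_inv X f x) = x" for x
    using HomeoD(2,3)[OF f] by (auto simp: homeo_inv_def f_inv_into_f)
  show "homeo_inv X f (f x) = x"
    using fi[of "f x"] Homeo_inj[OF f] by (metis injD)
qed

lemma Homeo_joined:
  assumes f: "f \<in> Homeo X" 
  shows "joined X (f p) (f a) (f b) \<longleftrightarrow> joined X p a b"
proof -
  have imp: "joined X (g p) (g a) (g b)" if g: "g \<in> Homeo X" and j: "joined X p a b" for g p a b
  proof -
    obtain C where C: "connectedin X C" "a \<in> C" "b \<in> C" "p \<notin> C"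
      using j joined_def by metis
    then have "connectedin X (g ` C)"
      using homeomorphic_map_connectedness[OF HomeoD(1)[OF g]] connectedin_subset_topspace by blast
    moreover have "g p \<notin> g ` C"
      using C(4) Homeo_inj[OF g] by (metis imageE injD)
    ultimately show ?thesis
      using C unfolding joined_def by blast
  qed
  show ?thesis
    using imp[OF f] imp[OF Homeo_inv(1)[OF f], of "f p" "f a" "f b"] Homeo_inv(3)[OF f] by metis
qed

text \<open>By injectivity a map sends points it moves to points it moves, so the other map fixes
  them before and after.\<close>

lemma disjoint_support_commute:
  assumes "inj f" "inj g" "\<And>x. f x = x \<or> g x = x"
  shows "f \<circ> g = g \<circ> f"
proof
  fix x
  show "(f \<circ> g) x = (g \<circ> f) x"
    using assms(3)[of x] assms(3)[of "f x"] assms(3)[of "g x"]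
      injD[OF assms(1), of "f x" x] injD[OF assms(2), of "g x" x] by force
qed

section \<open>Non-commuting homeomorphisms supported in one component\<close>

locale dendrite_group_topology = D_S_space +
  fixes T :: "('a \<Rightarrow> 'a) topology"
  assumes T: "hausdorff_group_topology_homeo X T"
begin

lemma Homeo_branch:
  assumes "f \<in> Homeo X" "p \<in> branch"
  shows "f p \<in> branch"
proof -
  obtain a b c where abc: "a \<in> topspace X - {p}" "b \<in> topspace X - {p}" "c \<in> topspace X - {p}"
      "\<not> joined X p a b" "\<not> joined X p b c" "\<not> joined X p a c"
    using three_classes[of p] assms(2) unfolding branch_def by blast
  have "f x \<in> topspace X - {f p}" if "x \<in> topspace X - {p}" for x
    using that assms(1) Homeo_in_space Homeo_inj by (metis Diff_iff injD singletonD singletonI)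
  then show ?thesis
    using branchI[of "f p" "f a" "f b" "f c"] abc Homeo_joined[OF assms(1)] assms Homeo_in_space branch_in_space
    by metis
qed

text \<open>On the way from \<open>x\<close> to \<open>c\<close> lie \<open>c1\<close> and then
  \<open>d\<close>. The map \<open>f\<close> pushes \<open>c1\<close> to \<open>d\<close>, and
  \<open>h\<close> moves \<open>e1\<close> to \<open>e2\<close> in a side arm at \<open>c1\<close>.
  As \<open>f\<close> carries \<open>e1\<close> beyond \<open>d\<close>, where \<open>h\<close> is
  the identity, \<open>h\<close> fixes \<open>f e1\<close>, whereas commuting would give
  \<open>h (f e1) = f e2\<close>.\<close>

lemma noncommuting_pair:
  assumes x: "x \<in> branch" and c: "c \<in> topspace X" "c \<noteq> x"
  obtains f h where "f \<in> Homeo X" "h \<in> Homeo X" "f \<circ> h \<noteq> h \<circ> f"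
    "\<And>y. \<not> joined X x c y \<Longrightarrow> f y = y" "\<And>y. \<not> joined X x c y \<Longrightarrow> h y = y"
proof -
  have xP: "x \<in> topspace X" using x branch_in_space by blast
  \<comment> \<open>All auxiliary branch points get the order of \<open>x\<close>, because
    \<open>homeo_moving\<close> requires equal orders.\<close>
  obtain d where d: "d \<in> branch" "\<not> joined X d x c" "d \<noteq> x" "d \<noteq> c" "ord d = ord x"
    using ord_dense[OF xP c(1) _ x] c(2) by blast
  have dP: "d \<in> topspace X" using d branch_in_space by blast
  have xcd: "joined X x c d"
    using joined_switch[OF xP dP c(1)] d joined_sym by blast
  obtain c1 where c1: "c1 \<in> branch" "\<not> joined X c1 x d" "c1 \<noteq> x" "c1 \<noteq> d" "ord c1 = ord x"
    using ord_dense[OF xP dP _ x] d(3) by blast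
  have c1P: "c1 \<in> topspace X" using c1 branch_in_space by blast
  have "joined X x d c1"
    using joined_switch[OF xP c1P dP] c1 joined_sym by blast
  then have xc1: "joined X x c c1"
    using xcd joined_trans by blast
  obtain f where f: "f \<in> Homeo X" "f c1 = d" "\<And>y. \<not> joined X x c y \<Longrightarrow> f y = y"
    using homeo_moving[OF x c1(1) d(1) _ xc1 xcd] c1(5) d(5) by auto
  \<comment> \<open>A third direction at \<open>c1\<close>: of three distinct components there, at
    most one contains \<open>x\<close> and at most one contains \<open>d\<close>.\<close>
  obtain e where e: "e \<in> topspace X" "e \<noteq> c1" "\<not> joined X c1 e x" "\<not> joined X c1 e d"
  proof -
    obtain u v w where uvw: "u \<in> topspace X - {c1}" "v \<in> topspace X - {c1}" "w \<in> topspace X - {c1}"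
        "\<not> joined X c1 u v" "\<not> joined X c1 v w" "\<not> joined X c1 u w"
      using three_classes[of c1] c1(1) unfolding branch_def by blast
    have "\<not> joined X c1 s y \<or> \<not> joined X c1 t y" if "\<not> joined X c1 s t" for s t y
      using that joined_sym joined_trans by blast
    then have "\<exists>e\<in>{u, v, w}. \<not> joined X c1 e x \<and> \<not> joined X c1 e d"
      using uvw(4-6) by (metis insert_iff)
    then show ?thesis
      using that uvw(1-3) by blast
  qed
  obtain e1 where e1: "e1 \<in> branch" "\<not> joined X e1 c1 e" "e1 \<noteq> c1" "e1 \<noteq> e" "ord e1 = ord x"
    using ord_dense[OF c1P e(1) _ x] e(2) by blast
  have e1P: "e1 \<in> topspace X" using e1 branch_in_space by blast
  have ce1: "joined X c1 e e1"
    using joined_switch[OF c1P e1P e(1)] e1 joined_sym by blast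
  obtain e2 where e2: "e2 \<in> branch" "\<not> joined X e2 c1 e1" "e2 \<noteq> c1" "e2 \<noteq> e1" "ord e2 = ord x"
    using ord_dense[OF c1P e1P _ x] e1(3) by blast
  have e2P: "e2 \<in> topspace X" using e2 branch_in_space by blast
  have "joined X c1 e1 e2"
    using joined_switch[OF c1P e2P e1P] e2 joined_sym by blast
  then have ce2: "joined X c1 e e2"
    using ce1 joined_trans by blast
  obtain h where h: "h \<in> Homeo X" "h e1 = e2" "\<And>y. \<not> joined X c1 e y \<Longrightarrow> h y = y"
    using homeo_moving[OF c1(1) e1(1) e2(1) _ ce1 ce2] e1(5) e2(5) by auto
  \<comment> \<open>The side arm of \<open>e\<close> at \<open>c1\<close> avoids \<open>x\<close>,
    so seen from \<open>x\<close> it lies in the component of \<open>c1\<close>, which is that of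
    \<open>c\<close>.\<close>
  have hsupp: "h y = y" if "\<not> joined X x c y" for y
  proof (rule h(3), rule notI)
    assume j: "joined X c1 e y"
    have "\<not> joined X c1 y x"
      using e(3) joined_trans[OF j] by blast
    moreover have "y \<in> topspace X"
      using joined_dom[OF j] by blast
    ultimately have "joined X x y c1"
      using joined_switch[OF c1P xP] c1(3) by blast
    then show False
      using that xc1 joined_sym joined_trans by blast
  qed
  have "f \<circ> h \<noteq> h \<circ> f"
  proof
    assume "f \<circ> h = h \<circ> f"
    then have eq: "f e2 = h (f e1)"
      using h(2) by (metis comp_apply)
    have "f e2 \<noteq> f e1"
      using e2(4) Homeo_inj[OF f(1)] by (metis injD)
    then have j: "joined X c1 e (f e1)"
      using eq h(3) by metis
    have "f x = x"
      using f(3) by (simp add: joined_def)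
    moreover have "\<not> joined X c1 e1 x"
      using ce1 e(3) joined_trans by blast
    ultimately have n: "\<not> joined X d (f e1) x"
      using Homeo_joined[OF f(1), of c1 e1 x] f(2) by simp
    have "\<not> joined X c1 (f e1) d"
      using j e(4) joined_trans by blast
    then have "joined X d (f e1) c1"
      using joined_switch[OF c1P dP, of "f e1"] joined_dom[OF j] c1(4) by blast
    moreover have "joined X d x c1"
      using joined_switch[OF c1P dP xP] c1(2,4) by blast
    ultimately show False
      using n joined_sym joined_trans by blast
  qed
  then show ?thesis
    using that f(1,3) h(1) hsupp by blast
qed

section \<open>Open stabilisers of branch points\<close>

lemma Hausdorff_T: "Hausdorff_space T"
  using T by (simp add: hausdorff_group_topology_homeo_def)

lemma topspace_T: "topspace T = Homeo X"
  using T by (simp add: hausdorff_group_topology_homeo_def)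

lemma continuous_comp:
  assumes "continuous_map T T F" "continuous_map T T G"
  shows "continuous_map T T (\<lambda>g. F g \<circ> G g)"
proof -
  have "continuous_map T T ((\<lambda>(f, g). f \<circ> g) \<circ> (\<lambda>g. (F g, G g)))"
    using T assms unfolding hausdorff_group_topology_homeo_def
    by (intro continuous_map_compose[OF continuous_map_pairedI]) auto
  then show ?thesis by (simp add: o_def)
qed

lemma continuous_const: "f \<in> Homeo X \<Longrightarrow> continuous_map T T (\<lambda>g. f)"
  by (simp add: topspace_T)

lemma continuous_inv: "continuous_map T T (homeo_inv X)"
  using T by (simp add: hausdorff_group_topology_homeo_def)

lemma continuous_ident: "continuous_map T T (\<lambda>g. g)"
  using continuous_map_id by (simp add: id_def)

lemma stabiliser_nhd_id:
  assumes x: "x \<in> branch"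
  obtains W where "openin T W" "id \<in> W" "\<And>g. g \<in> W \<Longrightarrow> g x = x"
proof -
  have xP: "x \<in> topspace X" using x branch_in_space by blast
  have nhd: "\<exists>W. openin T W \<and> id \<in> W \<and> (\<forall>g\<in>W. \<exists>y. joined X x c y \<and> joined X x c (g y))"
    if c: "c \<in> topspace X" "c \<noteq> x" for c
  proof -
    obtain f h where fh: "f \<in> Homeo X" "h \<in> Homeo X" "f \<circ> h \<noteq> h \<circ> f"
        "\<And>y. \<not> joined X x c y \<Longrightarrow> f y = y" "\<And>y. \<not> joined X x c y \<Longrightarrow> h y = y"
      using noncommuting_pair[OF x c] by blast
    define k where "k g = (g \<circ> f) \<circ> homeo_inv X g" for g
    have k: "continuous_map T T k"
      unfolding k_def by (intro continuous_comp continuous_ident continuous_inv continuous_const fh)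
    \<comment> \<open>The complement of the set where two continuous maps into a Hausdorff space
      agree; this is where the Hausdorff property of \<open>T\<close> enters.\<close>
    define W where "W = topspace T - {g \<in> topspace T. k g \<circ> h = h \<circ> k g}"
    have "closedin T {g \<in> topspace T. k g \<circ> h = h \<circ> k g}"
      by (rule closedin_continuous_maps_eq[OF Hausdorff_T]) (intro continuous_comp k continuous_const fh)+
    then have "openin T W"
      by (simp add: W_def openin_diff)
    moreover have "homeo_inv X id = id"
      using Homeo_inv(2)[OF Homeo_id, of X] by (intro ext) simp
    then have "k id = f"
      by (simp add: k_def)
    then have "id \<in> W"
      using fh(3) by (simp add: W_def topspace_T Homeo_id)
    moreover have "\<exists>y. joined X x c y \<and> joined X x c (g y)" if g: "g \<in> W" for g
    proof (rule ccontr)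
      assume none: "\<nexists>y. joined X x c y \<and> joined X x c (g y)"
      have gH: "g \<in> Homeo X" using g by (simp add: W_def topspace_T)
      have "inj (k g)"
        unfolding k_def using Homeo_inj gH fh Homeo_inv(1) by (metis inj_compose)
      \<comment> \<open>The conjugate \<open>k g\<close> is supported in the image under
        \<open>g\<close> of the component, which by assumption is disjoint from the component
        supporting \<open>h\<close>.\<close>
      moreover have "k g y = y \<or> h y = y" for y
      proof (cases "joined X x c y")
        case True
        then have "\<not> joined X x c (homeo_inv X g y)"
          using none Homeo_inv(2)[OF gH] by metis
        then show ?thesis
          using fh(4) Homeo_inv(2)[OF gH] by (simp add: k_def)
      qed (use fh(5) in blast)
      ultimately have "k g \<circ> h = h \<circ> k g"
        using disjoint_support_commute Homeo_inj[OF fh(2)] by blast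
      then show False
        using g by (simp add: W_def)
    qed
    ultimately show ?thesis by blast
  qed
  obtain a b c where abc: "a \<in> topspace X - {x}" "b \<in> topspace X - {x}" "c \<in> topspace X - {x}"
      "\<not> joined X x a b" "\<not> joined X x b c" "\<not> joined X x a c"
    using three_classes[of x] x unfolding branch_def by blast
  obtain A where "openin T A" "id \<in> A" and A: "\<forall>g\<in>A. \<exists>y. joined X x a y \<and> joined X x a (g y)"
    using nhd[of a] abc(1) by blast
  obtain B where "openin T B" "id \<in> B" and B: "\<forall>g\<in>B. \<exists>y. joined X x b y \<and> joined X x b (g y)"
    using nhd[of b] abc(2) by blast
  obtain C where "openin T C" "id \<in> C" and C: "\<forall>g\<in>C. \<exists>y. joined X x c y \<and> joined X x c (g y)"
    using nhd[of c] abc(3) by blast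
  show ?thesis
  proof
    show "openin T (A \<inter> B \<inter> C)" "id \<in> A \<inter> B \<inter> C"
      using \<open>openin T A\<close> \<open>openin T B\<close> \<open>openin T C\<close> \<open>id \<in> A\<close> \<open>id \<in> B\<close> \<open>id \<in> C\<close> by auto
    fix g assume g: "g \<in> A \<inter> B \<inter> C"
    then have gH: "g \<in> Homeo X"
      using \<open>openin T A\<close> openin_subset topspace_T by blast
    show "g x = x"
    proof (rule ccontr)
      assume ne: "g x \<noteq> x"
      have gxP: "g x \<in> topspace X" using Homeo_in_space[OF gH] xP by blast
      text \<open>Components of the complement of \<open>x\<close> not containing \<open>g x\<close> lie in a single component of the
        complement of \<open>g x\<close>, whereas \<open>g\<close> maps distinct components of the former to distinct ones of the
        latter.\<close>
      have pair: "joined X x u (g x) \<or> joined X x v (g x)" 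
        if uv: "\<exists>y. joined X x u y \<and> joined X x u (g y)" "\<exists>y. joined X x v y \<and> joined X x v (g y)" 
          "\<not> joined X x u v" for u v
      proof (rule ccontr)
        assume n: "\<not> (joined X x u (g x) \<or> joined X x v (g x))"
        obtain y z where y: "joined X x u y" "joined X x u (g y)" and z: "joined X x v z" "joined X x v (g z)"
          using uv by blast
        have "joined X (g x) w x" if "w \<in> topspace X" "\<not> joined X x w (g x)" for w
          using joined_switch[OF xP gxP that(1) ne[symmetric]] that(2) by simp
        then have "joined X (g x) (g y) x" "joined X (g x) (g z) x"
          using n y z joined_dom joined_trans by meson+
        then have "joined X (g x) (g y) (g z)"
          using joined_sym joined_trans by blast
        then have "joined X x y z"
          using Homeo_joined[OF gH] by blast
        then show False
          using y z uv(3) joined_sym joined_trans by meson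
      qed
      \<comment> \<open>If of any two of the three components one contains \<open>g x\<close>, then
        two of them do, although they are disjoint.\<close>
      have "joined X x a (g x) \<or> joined X x b (g x)" "joined X x b (g x) \<or> joined X x c (g x)"
          "joined X x a (g x) \<or> joined X x c (g x)"
        using g A B C by (intro pair abc(4-6); blast)+
      then show False
        using abc(4-6) joined_sym joined_trans by meson
    qed
  qed
qed

section \<open>Comparison with the compact-open topology\<close>

lemma agreement_nhd:
  assumes f: "f \<in> Homeo X" and "finite B" "B \<subseteq> branch"
  obtains W where "openin T W" "f \<in> W" "\<And>g b. g \<in> W \<Longrightarrow> b \<in> B \<Longrightarrow> g b = f b"
proof -
  have "\<exists>W. openin T W \<and> f \<in> W \<and> (\<forall>g\<in>W. g b = f b)" if b: "b \<in> B" for b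
  proof -
    obtain V where V: "openin T V" "id \<in> V" "\<And>g. g \<in> V \<Longrightarrow> g b = b"
      using stabiliser_nhd_id[of b] b assms(3) by blast
    let ?F = "\<lambda>g. homeo_inv X f \<circ> g"
    have "continuous_map T T ?F"
      by (intro continuous_comp continuous_const Homeo_inv f continuous_ident)
    then have "openin T {g \<in> topspace T. ?F g \<in> V}"
      using V(1) openin_continuous_map_preimage by blast
    moreover have "?F f = id"
      using Homeo_inv(3)[OF f] by auto
    moreover have "g b = f b" if "?F g \<in> V" for g
      using V(3)[OF that] Homeo_inv(2)[OF f] by (metis comp_apply)
    ultimately show ?thesis
      using V(2) f topspace_T by (intro exI[of _ "{g \<in> topspace T. ?F g \<in> V}"]) auto
  qed
  then obtain W where W: "\<And>b. b \<in> B \<Longrightarrow> openin T (W b)" "\<And>b. b \<in> B \<Longrightarrow> f \<in> W b" 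
      "\<And>b g. b \<in> B \<Longrightarrow> g \<in> W b \<Longrightarrow> g b = f b"
    by metis
  show ?thesis
  proof
    show "openin T (topspace T \<inter> \<Inter>(W ` B))"
      using assms(2) W(1) by (cases "B = {}") (auto intro!: openin_Int openin_Inter)
    show "f \<in> topspace T \<inter> \<Inter>(W ` B)"
      using f W(2) topspace_T by auto
    show "g b = f b" if "g \<in> topspace T \<inter> \<Inter>(W ` B)" "b \<in> B" for g b
      using that W(3) by blast
  qed
qed

text \<open>Around \<open>f p\<close> the set \<open>U\<close> contains a finite intersection of
  components, each named by two branch points. A homeomorphism agreeing with \<open>f\<close> at the
  preimages of these points maps the preimages of the components onto the same components.\<close>

lemma finite_determination:
  assumes f: "f \<in> Homeo X" and p: "p \<in> topspace X" and U: "openin X U" "f p \<in> U"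
  shows "\<exists>W B. openin X W \<and> p \<in> W \<and> finite B \<and> B \<subseteq> branch \<and> 
           (\<forall>g\<in>Homeo X. (\<forall>b\<in>B. g b = f b) \<longrightarrow> g ` W \<subseteq> U)"
proof -
  obtain Q where Q: "finite Q" "Q \<subseteq> branch \<times> branch" "\<And>q a. (q, a) \<in> Q \<Longrightarrow> joined X q a (f p)"
      "{z \<in> topspace X. \<forall>(q, a)\<in>Q. joined X q a z} \<subseteq> U"
    using classes_subbase[OF U] by blast
  let ?i = "homeo_inv X f"
  note i = Homeo_inv[OF f]
  define W where "W = topspace X \<inter> (\<Inter>(q, a)\<in>Q. Collect (joined X (?i q) (?i a)))"
  define B where "B = ?i ` (fst ` Q \<union> snd ` Q)"
  have "openin X W"
    unfolding W_def using Q(1) openin_joined by (cases "Q = {}") (auto intro!: openin_Int openin_Inter)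
  moreover have "joined X (?i q) (?i a) p" if "(q, a) \<in> Q" for q a
    using Q(3)[OF that] Homeo_joined[OF i(1), of q a "f p"] i(3) by simp
  then have "p \<in> W"
    using p by (auto simp: W_def)
  moreover have "finite B" using Q(1) by (simp add: B_def)
  moreover have "B \<subseteq> branch"
    using Q(2) Homeo_branch[OF i(1)] by (auto simp: B_def)
  moreover have "g y \<in> U" if g: "g \<in> Homeo X" "\<forall>b\<in>B. g b = f b" and y: "y \<in> W" for g y
  proof -
    have "joined X q a (g y)" if qa: "(q, a) \<in> Q" for q a
    proof -
      have "?i q \<in> B" "?i a \<in> B"
        using qa by (force simp: B_def)+
      then have "g (?i q) = q" "g (?i a) = a"
        using g(2) i(2) by auto
      moreover have "joined X (?i q) (?i a) y"
        using y qa by (auto simp: W_def)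
      ultimately show ?thesis
        using Homeo_joined[OF g(1), of "?i q" "?i a" y] by simp
    qed
    moreover have "g y \<in> topspace X"
      using y Homeo_in_space[OF g(1)] by (auto simp: W_def)
    ultimately show ?thesis
      using Q(4) by blast
  qed
  ultimately show ?thesis by blast
qed

lemma openin_compact_open_subbase:
  assumes K: "compactin X K" and U: "openin X U"
  shows "openin T (Homeo X \<inter> {f. f ` K \<subseteq> U})"
proof (subst openin_subopen, intro ballI)
  fix f assume "f \<in> Homeo X \<inter> {f. f ` K \<subseteq> U}"
  then have f: "f \<in> Homeo X" "f ` K \<subseteq> U" by auto
  have KX: "K \<subseteq> topspace X" using K compactin_subset_topspace by blast
  define R where "R p W B \<longleftrightarrow> openin X W \<and> p \<in> W \<and> finite B \<and> B \<subseteq> branch \<and> 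
           (\<forall>g\<in>Homeo X. (\<forall>b\<in>B. g b = f b) \<longrightarrow> g ` W \<subseteq> U)" for p W B
  have "\<exists>W B. R p W B" if "p \<in> K" for p
    unfolding R_def by (rule finite_determination[OF f(1) _ U]) (use that f(2) KX in blast)+
  then obtain W B where R: "\<And>p. p \<in> K \<Longrightarrow> R p (W p) (B p)"
    by metis
  then have WB: "\<And>p. p \<in> K \<Longrightarrow> openin X (W p)" "\<And>p. p \<in> K \<Longrightarrow> p \<in> W p" 
      "\<And>p. p \<in> K \<Longrightarrow> finite (B p)" "\<And>p. p \<in> K \<Longrightarrow> B p \<subseteq> branch"
      "\<And>p g. p \<in> K \<Longrightarrow> g \<in> Homeo X \<Longrightarrow> \<forall>b\<in>B p. g b = f b \<Longrightarrow> g ` W p \<subseteq> U"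
    unfolding R_def by blast+
  have "\<exists>\<F>. finite \<F> \<and> \<F> \<subseteq> W ` K \<and> K \<subseteq> \<Union>\<F>"
    using WB(1,2) by (intro K[unfolded compactin_def, THEN conjunct2, rule_format, of "W ` K"]) auto
  then obtain F where F: "finite F" "F \<subseteq> K" "K \<subseteq> \<Union>(W ` F)"
    by (metis finite_subset_image)
  have "finite (\<Union>(B ` F))" "\<Union>(B ` F) \<subseteq> branch"
    using F(1,2) WB(3,4) by blast+
  then obtain V where V: "openin T V" "f \<in> V" "\<And>g b. g \<in> V \<Longrightarrow> b \<in> \<Union>(B ` F) \<Longrightarrow> g b = f b"
    using agreement_nhd[OF f(1)] by blast
  have "g ` K \<subseteq> U" if g: "g \<in> V" for g
  proof -
    have gH: "g \<in> Homeo X"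
      using g openin_subset[OF V(1)] topspace_T by blast
    have "g ` W p \<subseteq> U" if "p \<in> F" for p
      using WB(5)[OF _ gH] V(3)[OF g] that F(2) by blast
    then show ?thesis
      using F(3) by blast
  qed
  then show "\<exists>V. openin T V \<and> f \<in> V \<and> V \<subseteq> Homeo X \<inter> {f. f ` K \<subseteq> U}"
    using V(1,2) openin_subset[OF V(1)] topspace_T by (intro exI[of _ V]) auto
qed

lemma compact_open_coarser:
  assumes "openin (compact_open_homeo X) U"
  shows "openin T U"
proof -
  define \<S> where "\<S> = {{f. f ` K \<subseteq> U} | K U. compactin X K \<and> openin X U}"
  obtain V where V: "openin (topology_generated_by \<S>) V" "U = V \<inter> Homeo X"
    using assms unfolding compact_open_homeo_def openin_subtopology \<S>_def by blast
  have "generate_topology_on \<S> V"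
    using V(1) by (rule openin_topology_generated_by)
  \<comment> \<open>The generated topology lives on all functions, so the induction is run on traces
    on \<open>Homeo X\<close>.\<close>
  then have "openin T (Homeo X \<inter> V)"
  proof induction
    case (Int a b)
    moreover have "Homeo X \<inter> (a \<inter> b) = (Homeo X \<inter> a) \<inter> (Homeo X \<inter> b)" by blast
    ultimately show ?case
      by (metis openin_Int)
  next
    case (UN K)
    have "openin T (\<Union>((\<inter>) (Homeo X) ` K))"
      using UN by (intro openin_Union) auto
    moreover have "\<Union>((\<inter>) (Homeo X) ` K) = Homeo X \<inter> \<Union>K" by blast
    ultimately show ?case
      by (rule back_subst)
  next
    case (Basis s)
    then obtain K V where "s = {f. f ` K \<subseteq> V}" "compactin X K" "openin X V"
      unfolding \<S>_def by blast
    then show ?case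
      using openin_compact_open_subbase by blast
  qed simp
  then show ?thesis
    using V(2) by (simp add: Int_commute)
qed

end

theorem theorem1p7:
  fixes S :: "enat set" and X :: "'a topology"
  assumes "S \<noteq> {}" and "S \<subseteq> {n. n \<ge> 3}"
    and "is_D_S S X"
  shows "\<forall>T. hausdorff_group_topology_homeo X T \<longrightarrow>
           (\<forall>U. openin (compact_open_homeo X) U \<longrightarrow> openin T U)"
proof (intro allI impI)
  fix T U assume "hausdorff_group_topology_homeo X T" and U: "openin (compact_open_homeo X) U"
  then interpret dendrite_group_topology S X T
    using assms by unfold_locales
  show "openin T U"
    using U by (rule compact_open_coarser)
qed

end
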